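(* Let $A_0=\begin{pmatrix}1&1\\0&1\end{pmatrix}$, $A_1=\begin{pmatrix}1&0\\1&1\end{pmatrix}$, with $1$-ratio function $\mathfrak{r}$. Let $\gamma\in(0,1/2)$ be irrational with continued fraction expansion $\gamma=[a_1,a_2,\ldots]$ (so $a_1\ge2$) and convergents $p_n/q_n$, let $\alpha_\gamma$ be the unique element of $\mathfrak{r}^{-1}(\gamma)$, and let $\rho_n:=\rho(\mathcal{A}(s_n))$ for $n\ge-1$, where $s_{-1}:=1$, $s_0:=0$, $s_1:=s_0^{a_1-1}s_{-1}$, $s_{n+1}:=s_n^{a_{n+1}}s_{n-1}$ for $n\ge1$. Suppose there exist a constant $L>0$ and an integer $n_0\ge3$ such that \[q_n\le L\rho_{n-1}\quad\text{for all } n>n_0.\] Then for every $N\ge n_0$, \[\left|\log\alpha_\gamma-\log\left(\prod_{n=0}^N\left(\frac{\rho_n^{a_{n+1}}\rho_{n-1}}{\rho_{n+1}}\right)^{(-1)^nq_n}\right)\right|\le\frac{2LC_0}{\rho_N},\] where $C_0:=16(a_1+1)(a_1+2)+1$.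
   Context: Continued fractions: $[a_1,a_2,\ldots]=\cfrac{1}{a_1+\cfrac{1}{a_2+\cdots}}$ with positive integers $a_i$; $p_n/q_n=[a_1,\ldots,a_n]$ in least terms, and $q_0:=1$. $\rho(B)$ is the spectral radius of a matrix $B$. For a finite word $u=u_1\cdots u_m$ over $\{0,1\}$, $\mathcal{A}(u):=A_{u_m}\cdots A_{u_1}$; juxtaposition of words is concatenation and $u^k$ is the $k$-fold concatenation. The $1$-ratio function. For $\alpha\ge0$ put $A_0^{(\alpha)}:=A_0$, $A_1^{(\alpha)}:=\alpha A_1$, and let $\varrho(\alpha):=\lim_{n\to\infty}\max\{\|A^{(\alpha)}_{i_n}\cdots A^{(\alpha)}_{i_1}\|^{1/n}: i_j\in\{0,1\}\}$ be the joint spectral radius of $\{A_0^{(\alpha)},A_1^{(\alpha)}\}$. For this pair of matrices it is known that there is a unique function $\mathfrak{r}\colon[0,\infty)\to[0,1]$ such that for every $\alpha\ge0$ and every $x\in\{0,1\}^{\mathbb{N}}$ with $\|A^{(\alpha)}_{x_n}\cdots A^{(\alpha)}_{x_1}\|^{1/n}\to\varrho(\alpha)$ one has $n^{-1}\#\{1\le i\le n:x_i=1\}\to\mathfrak{r}(\alpha)$; this is the $1$-ratio function. For irrational $\gamma\in(0,1)$ the set $\mathfrak{r}^{-1}(\gamma)$ is a singleton, and its element satisfies $\alpha_\gamma=\lim_{N\to\infty}\prod_{n=0}^N\left(\rho_n^{a_{n+1}}\rho_{n-1}/\rho_{n+1}\right)^{(-1)^nq_n}$ (note $\rho(A_1)=1$).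 *)

theory Defs
  imports "HOL-Analysis.Analysis"
begin

datatype letter = Zero | One

fun A_mat :: "letter \<Rightarrow> real^2^2" where
  "A_mat Zero = vector [vector [1, 1], vector [0, 1]]"
| "A_mat One = vector [vector [1, 0], vector [1, 1]]"

fun A_weighted :: "real \<Rightarrow> letter \<Rightarrow> real^2^2" where
  "A_weighted \<alpha> Zero = A_mat Zero"
| "A_weighted \<alpha> One = \<alpha> *\<^sub>R A_mat One"

text \<open>The product reverses the order of the letters: the word \<open>[u1, ..., um]\<close> is sent to
  \<open>B um ** ... ** B u1\<close>.\<close>

fun word_prod :: "(letter \<Rightarrow> real^'n^'n) \<Rightarrow> letter list \<Rightarrow> real^'n^'n" where
  "word_prod B [] = mat 1"
| "word_prod B (x # u) = word_prod B u ** B x"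

definition word_power :: "letter list \<Rightarrow> nat \<Rightarrow> letter list" where
  "word_power u k = concat (replicate k u)"

definition spectral_radius :: "real^'n^'n \<Rightarrow> real" where
  "spectral_radius B =
     Max (cmod ` {c. \<exists>v. v \<noteq> 0 \<and> map_matrix complex_of_real B *v v = c *s v})"

text \<open>The norm is the Euclidean operator norm; the joint spectral radius and the growth rates
  below do not depend on the choice of a norm.\<close>

definition growth :: "(letter \<Rightarrow> real^'n^'n) \<Rightarrow> letter list \<Rightarrow> real" where
  "growth B u = root (length u) (onorm ((*v) (word_prod B u)))"

definition joint_spectral_radius :: "(letter \<Rightarrow> real^'n^'n) \<Rightarrow> real" where
  "joint_spectral_radius B = lim (\<lambda>n. Max {growth B u | u. length u = n})"

text \<open>Infinite words are indexed from 0, so \<open>map x [0..<n]\<close> is the prefix of length \<open>n\<close>.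
  On the half-line \<open>\<alpha> \<ge> 0\<close> at most one function has this property; its values at negative
  arguments are irrelevant.\<close>

definition is_one_ratio_function :: "(real \<Rightarrow> real) \<Rightarrow> bool" where
  "is_one_ratio_function r \<longleftrightarrow>
     r \<in> {0..} \<rightarrow> {0..1} \<and>
     (\<forall>\<alpha>\<ge>0. \<forall>x.
        (\<lambda>n. growth (A_weighted \<alpha>) (map x [0..<n]))
           \<longlonglongrightarrow> joint_spectral_radius (A_weighted \<alpha>) \<longrightarrow>
        (\<lambda>n. real (card {i. i < n \<and> x i = One}) / real n) \<longlonglongrightarrow> r \<alpha>)"

fun cfrac :: "nat list \<Rightarrow> rat" where
  "cfrac [] = 0"
| "cfrac (a # as) = 1 / (of_nat a + cfrac as)"

text \<open>Partial quotients \<open>a 1, a 2, ...\<close> are indexed from 1; the value \<open>a 0\<close> is never used.\<close>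

definition convergent_cf :: "(nat \<Rightarrow> nat) \<Rightarrow> nat \<Rightarrow> rat" where
  "convergent_cf a n = cfrac (map a [1..<Suc n])"

definition has_cf_expansion :: "real \<Rightarrow> (nat \<Rightarrow> nat) \<Rightarrow> bool" where
  "has_cf_expansion \<gamma> a \<longleftrightarrow>
     (\<forall>i\<ge>1. a i \<ge> 1) \<and> (\<lambda>n. real_of_rat (convergent_cf a n)) \<longlonglongrightarrow> \<gamma>"

text \<open>The denominator in lowest terms; in particular \<open>cf_q a 0 = 1\<close>.\<close>

definition cf_q :: "(nat \<Rightarrow> nat) \<Rightarrow> nat \<Rightarrow> int" where
  "cf_q a n = snd (quotient_of (convergent_cf a n))"

text \<open>The words \<open>s\<^sub>k\<close> for \<open>k \<ge> -1\<close>, with the index shifted by one: \<open>std_word_shift a k\<close> is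
  \<open>s\<close> at \<open>k - 1\<close>.\<close>

fun std_word_shift :: "(nat \<Rightarrow> nat) \<Rightarrow> nat \<Rightarrow> letter list" where
  "std_word_shift a 0 = [One]"
| "std_word_shift a (Suc 0) = [Zero]"
| "std_word_shift a (Suc (Suc 0)) = word_power [Zero] (a 1 - 1) @ [One]"
| "std_word_shift a (Suc (Suc (Suc n))) =
     word_power (std_word_shift a (Suc (Suc n))) (a (n + 2)) @ std_word_shift a (Suc n)"

definition std_word :: "(nat \<Rightarrow> nat) \<Rightarrow> int \<Rightarrow> letter list" where
  "std_word a k = std_word_shift a (nat (k + 1))"

definition rho :: "(nat \<Rightarrow> nat) \<Rightarrow> int \<Rightarrow> real" where
  "rho a k = spectral_radius (word_prod A_mat (std_word a k))"

end

theory Submission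
  imports Defs
begin

text \<open>Let \<open>c = ln \<varrho>(\<alpha>)\<close>, \<open>t = ln \<alpha>\<close> and let \<open>D\<^sub>n = q\<^sub>n c - ln \<rho>\<^sub>n - p\<^sub>n t \<ge> 0\<close> be the optimality gap of
  \<open>s\<^sub>n\<close>. The logarithm of the partial product telescopes to
  \<open>(-1)\<^sup>N (q\<^bsub>N+1\<^esub> ln \<rho>\<^sub>N - q\<^sub>N ln \<rho>\<^bsub>N+1\<^esub>)\<close>, which differs from \<open>t\<close> by
  \<open>\<plusminus>(q\<^bsub>N+1\<^esub> D\<^sub>N - q\<^sub>N D\<^bsub>N+1\<^esub>)\<close>, so the gaps have to be small.

  Consecutive matrices \<open>P = \<A>(s\<^sub>n)\<close>, \<open>Q = \<A>(s\<^bsub>n-1\<^esub>)\<close> have a commutator of determinant \<open>-1\<close>. Hence the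
  Fricke identity \<open>x\<^sup>2 + y\<^sup>2 + z\<^sup>2 - xyz = 5\<close> holds for the traces of \<open>P\<close>, \<open>Q\<close>, \<open>QP\<close>, and spectral radii
  are multiplicative up to a factor \<open>1 + O(1 / (\<rho>(P) \<rho>(Q)))\<close>; this controls the defects
  \<open>ln (\<rho>\<^bsub>n+1\<^esub> / (\<rho>\<^sub>n\<^sup>a \<rho>\<^bsub>n-1\<^esub>))\<close> in the linear recursion for \<open>D\<^sub>n\<close>. Moreover, reversing an arc
  of a cyclic word changes its trace by an explicit product of two traces against the commutator,
  whose signs are known; a word of maximal trace with given letter counts can therefore be
  desubstituted along the continued fraction. Applied to prefixes of an extremal sequence, whose
  frequency of ones is \<open>\<gamma>\<close> by the hypothesis on \<open>r\<close>, this shows that \<open>D\<^sub>n\<close> is bounded. The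
  recursion then forces \<open>D\<^sub>N + D\<^bsub>N+1\<^esub>\<close> to be at most the sum of the defects beyond \<open>N\<close>.\<close>

section \<open>Pairs of matrices with commutator of determinant \<open>-1\<close>\<close>

lemmas mat2_simps = matrix_matrix_mult_def vec_eq_iff forall_2 sum_2 det_2 trace_def mat_def

lemma word_prod_append: "word_prod B (u @ v) = word_prod B v ** word_prod B u"
  by (induction u) (simp_all add: matrix_mul_assoc)

lemma trace_word_prod_commute:
  "trace (word_prod B (u @ v)) = trace (word_prod B (v @ u))"
  unfolding word_prod_append by (rule trace_mul_sym)

lemma word_prod_concat:
  "word_prod (\<lambda>x. word_prod B (f x)) u = word_prod B (concat (map f u))"
  by (induction u) (simp_all add: word_prod_append)

lemma word_prod_scaleR:
  "word_prod (A_weighted \<alpha>) u = \<alpha> ^ count_list u One *\<^sub>R word_prod A_mat u"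
proof (induction u)
  case (Cons x u)
  then show ?case
    by (cases x; simp add: Cons.IH; simp add: mat2_simps algebra_simps)
qed simp

definition commutator :: "(letter \<Rightarrow> real^2^2) \<Rightarrow> real^2^2" where
  "commutator B = B One ** B Zero - B Zero ** B One"

text \<open>The inequality for \<open>trace (B One ** B Zero)\<close> selects the larger root of the
  Fricke identity, read as a quadratic equation in that trace. The last two conditions fix the sign
  by which reversing an arc changes a trace. All of them survive \<open>fold_pair\<close> and
  \<open>swap_pair\<close>.\<close>

definition good_pair :: "(letter \<Rightarrow> real^2^2) \<Rightarrow> bool" where
  "good_pair B \<longleftrightarrow>
     (\<forall>x. det (B x) = 1 \<and> trace (B x) \<ge> 2) \<and> det (commutator B) = -1 \<and>
     2 * trace (B One ** B Zero) \<ge> trace (B One) * trace (B Zero) \<and>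
     (\<forall>u. trace (commutator B ** word_prod B (Zero # u @ [One])) > 0) \<and>
     (\<forall>u. trace (commutator B ** word_prod B (One # u @ [Zero])) < 0)"

definition swap_pair :: "(letter \<Rightarrow> 'a) \<Rightarrow> letter \<Rightarrow> 'a" where
  "swap_pair B = case_letter (B One) (B Zero)"

text \<open>Words over the new pair are words over \<open>B\<close> in which each \<open>One\<close>
  is preceded by a \<open>Zero\<close> of its own; see \<open>fold_word\<close>.\<close>

definition fold_pair :: "(letter \<Rightarrow> real^2^2) \<Rightarrow> letter \<Rightarrow> real^2^2" where
  "fold_pair B = case_letter (B Zero) (B One ** B Zero)"

lemma trace_commutator:
  "trace (commutator B) = 0" "trace (commutator B ** B x) = 0"
proof -
  show "trace (commutator B) = 0"
    by (simp add: commutator_def mat2_simps algebra_simps)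
  show "trace (commutator B ** B x) = 0"
    by (cases x; simp add: commutator_def mat2_simps algebra_simps)
qed

text \<open>A traceless 2 by 2 matrix is minus its adjugate. Applied to \<open>C\<close> and to
  \<open>C ** P\<close>, this says that the inverse of \<open>P\<close> times \<open>C\<close>
  equals \<open>C ** P\<close>.\<close>

lemma sandwich_traceless:
  fixes C P :: "real^2^2"
  assumes "trace C = 0" "trace (C ** P) = 0" "det P = 1"
  shows "P ** C ** P = C"
proof -
  have *: "C$2$2 = - C$1$1" "C$1$1*P$1$1 + C$1$2*P$2$1 + C$2$1*P$1$2 + C$2$2*P$2$2 = 0"
    "P$1$1*P$2$2 - P$1$2*P$2$1 = 1"
    using assms by (simp_all add: mat2_simps algebra_simps)
  show ?thesis
    using * by (simp add: mat2_simps, intro conjI; algebra)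
qed

text \<open>By Cayley-Hamilton \<open>C ** C\<close> is the identity, and subtracting
  \<open>trace (C ** M)\<close> times \<open>C\<close> from \<open>M\<close> yields C adj(M) C. This
  map of \<open>M\<close> is therefore an anti-automorphism. It fixes \<open>P\<close> because
  \<open>C ** P\<close> is traceless, and the equation is its value at
  \<open>M ** P\<close>.\<close>

lemma reversal_step:
  fixes C P M :: "real^2^2"
  assumes "trace C = 0" "trace (C ** P) = 0" "det P = 1" "det C = -1"
  shows "P ** (M - trace (C ** M) *\<^sub>R C) = M ** P - trace (C ** (M ** P)) *\<^sub>R C"
proof -
  have *: "C$2$2 = - C$1$1" "C$1$1*P$1$1 + C$1$2*P$2$1 + C$2$1*P$1$2 + C$2$2*P$2$2 = 0"
    "P$1$1*P$2$2 - P$1$2*P$2$1 = 1" "C$1$1*C$2$2 - C$1$2*C$2$1 = -1"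
    using assms by (simp_all add: mat2_simps algebra_simps)
  show ?thesis
    using * by (simp add: mat2_simps, intro conjI; algebra)
qed

lemma word_prod_rev:
  assumes "\<And>x. det (B x) = 1" "det (commutator B) = -1"
  shows "word_prod B (rev u) =
    word_prod B u - trace (commutator B ** word_prod B u) *\<^sub>R commutator B"
proof (induction u)
  case Nil
  then show ?case by (simp add: trace_commutator)
next
  case (Cons x u)
  then show ?case
    using reversal_step[OF trace_commutator(1) trace_commutator(2) assms]
    by (simp add: word_prod_append)
qed

lemma trace_word_prod_rev:
  assumes "\<And>x. det (B x) = 1" "det (commutator B) = -1"
  shows "trace (word_prod B (rev u) ** M) =
    trace (word_prod B u ** M) - trace (commutator B ** word_prod B u) * trace (commutator B ** M)"
  unfolding word_prod_rev[OF assms] by (simp add: mat2_simps algebra_simps)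

text \<open>Fricke's trace identity: for unit determinants and commutator determinant -1 it becomes
  x^2 + y^2 + z^2 - x y z = 5 in the three traces.\<close>

lemma det_commutator:
  "det (commutator B) = 4 * det (B Zero) * det (B One)
    + trace (B One) * trace (B Zero) * trace (B One ** B Zero)
    - (trace (B Zero))\<^sup>2 * det (B One) - (trace (B One))\<^sup>2 * det (B Zero)
    - (trace (B One ** B Zero))\<^sup>2"
  unfolding commutator_def by (simp add: mat2_simps power2_eq_square algebra_simps)

section \<open>Good pairs under substitution and exchange of letters\<close>

definition fold_word :: "letter \<Rightarrow> letter list" where
  "fold_word = case_letter [Zero] [Zero, One]"

lemma word_prod_fold_pair:
  "word_prod (fold_pair B) u = word_prod B (concat (map fold_word u))"
proof -
  have "fold_pair B = (\<lambda>x. word_prod B (fold_word x))"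
  proof
    show "fold_pair B x = word_prod B (fold_word x)" for x
      by (cases x) (simp_all add: fold_pair_def fold_word_def)
  qed
  then show ?thesis
    by (simp add: word_prod_concat)
qed

lemma commutator_fold_pair: "commutator (fold_pair B) = commutator B ** B Zero"
  by (simp add: commutator_def fold_pair_def mat2_simps algebra_simps)

text \<open>By \<open>commutator_fold_pair\<close> the new commutator carries an extra factor
  \<open>B Zero\<close>; it cancels against the leading \<open>Zero\<close> of a nonempty image
  word.\<close>

lemma trace_commutator_sandwich:
  assumes "det (B Zero) = 1"
  shows "trace (commutator B ** B Zero ** (M ** B Zero)) = trace (commutator B ** M)"
proof -
  have "trace (commutator B ** B Zero ** (M ** B Zero))
      = trace (B Zero ** (commutator B ** B Zero ** M))"
    by (metis matrix_mul_assoc trace_mul_sym)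
  also have "\<dots> = trace ((B Zero ** commutator B ** B Zero) ** M)"
    by (simp add: matrix_mul_assoc)
  also have "\<dots> = trace (commutator B ** M)"
    using sandwich_traceless[OF trace_commutator(1) trace_commutator(2)[of B Zero] assms] by simp
  finally show ?thesis .
qed

lemma good_pair_fold:
  assumes good: "good_pair B"
  shows "good_pair (fold_pair B)"
proof -
  have det1: "det (B x) = 1" and tr2: "trace (B x) \<ge> 2" and detc: "det (commutator B) = -1"
    and z: "2 * trace (B One ** B Zero) \<ge> trace (B One) * trace (B Zero)"
    and pos: "trace (commutator B ** word_prod B (Zero # u @ [One])) > 0"
    and neg: "trace (commutator B ** word_prod B (One # u @ [Zero])) < 0" for x u
    using good by (auto simp: good_pair_def)
  have prod4: "trace (B One) * trace (B Zero) \<ge> 2 * 2"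
    using tr2 by (intro mult_mono) (auto intro: order_trans[OF _ tr2])
  have 1: "det (fold_pair B x) = 1 \<and> trace (fold_pair B x) \<ge> 2" for x
    using det1 tr2 z prod4 by (cases x) (auto simp: fold_pair_def det_mul)
  have 2: "det (commutator (fold_pair B)) = -1"
    by (simp add: commutator_fold_pair det_mul det1 detc)
  have 3: "2 * trace (fold_pair B One ** fold_pair B Zero)
      \<ge> trace (fold_pair B One) * trace (fold_pair B Zero)"
  proof -
    \<comment> \<open>Cayley-Hamilton: with x, y, z the traces of \<open>B One\<close>,
      \<open>B Zero\<close>, \<open>B One ** B Zero\<close>, the new trace is y z - x. The claim
      reduces to y z >= 2 x, which follows from 2 y z >= y^2 x >= 4 x.\<close>
    have "trace (B One ** B Zero ** B Zero)
        = trace (B Zero) * trace (B One ** B Zero) - det (B Zero) * trace (B One)"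
      by (simp add: mat2_simps algebra_simps)
    moreover have "trace (B Zero) * (2 * trace (B One ** B Zero))
        \<ge> trace (B Zero) * (trace (B One) * trace (B Zero))"
      using z tr2[of Zero] by (intro mult_left_mono) auto
    moreover have "(trace (B Zero) * trace (B Zero)) * trace (B One) \<ge> (2 * 2) * trace (B One)"
      using tr2[of Zero] tr2[of One] by (intro mult_right_mono mult_mono) auto
    ultimately show ?thesis
      by (simp add: fold_pair_def det1 algebra_simps)
  qed
  have 4: "trace (commutator (fold_pair B) ** word_prod (fold_pair B) (Zero # u @ [One])) > 0" for u
  proof -
    \<comment> \<open>Every \<open>fold_word\<close> starts with \<open>Zero\<close>, so after the
      leading \<open>Zero\<close> is split off the image word still begins with \<open>Zero\<close>
      and ends with \<open>One\<close>.\<close>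
    obtain v where v: "concat (map fold_word u) @ [Zero, One] = Zero # v @ [One]"
      by (cases u; cases "hd u") (auto simp: fold_word_def)
    have "word_prod (fold_pair B) (Zero # u @ [One]) =
        word_prod B (Zero # (concat (map fold_word u) @ [Zero, One]))"
      unfolding word_prod_fold_pair by (simp add: fold_word_def)
    also have "\<dots> = word_prod B (Zero # v @ [One]) ** B Zero"
      unfolding v by simp
    finally have "trace (commutator (fold_pair B) ** word_prod (fold_pair B) (Zero # u @ [One]))
       = trace (commutator B ** word_prod B (Zero # v @ [One]))"
      unfolding commutator_fold_pair using trace_commutator_sandwich[OF det1] by simp
    then show ?thesis
      using pos by simp
  qed
  have 5: "trace (commutator (fold_pair B) ** word_prod (fold_pair B) (One # u @ [Zero])) < 0" for u
  proof -
    have "word_prod (fold_pair B) (One # u @ [Zero]) =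
        word_prod B (One # concat (map fold_word u) @ [Zero]) ** B Zero"
      unfolding word_prod_fold_pair by (simp add: fold_word_def)
    then have "trace (commutator (fold_pair B) ** word_prod (fold_pair B) (One # u @ [Zero]))
       = trace (commutator B ** word_prod B (One # concat (map fold_word u) @ [Zero]))"
      unfolding commutator_fold_pair using trace_commutator_sandwich[OF det1] by simp
    then show ?thesis
      using neg by simp
  qed
  show ?thesis
    unfolding good_pair_def using 1 2 3 4 5 by blast
qed

definition swap_letter :: "letter \<Rightarrow> letter" where
  "swap_letter = case_letter One Zero"

lemma word_prod_swap_pair: "word_prod (swap_pair B) u = word_prod B (map swap_letter u)"
proof (induction u)
  case (Cons x u)
  then show ?case by (cases x) (simp_all add: swap_pair_def swap_letter_def)
qed simp

lemma count_list_swap: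
  "count_list (map swap_letter u) Zero = count_list u One"
  "count_list (map swap_letter u) One = count_list u Zero"
proof (induction u)
  case (Cons x u)
  { case 1 show ?case using Cons by (cases x) (simp_all add: swap_letter_def) }
  { case 2 show ?case using Cons by (cases x) (simp_all add: swap_letter_def) }
qed simp_all

lemma map_swap_letter_swap: "map swap_letter (map swap_letter u) = u"
proof -
  have "swap_letter (swap_letter x) = x" for x
    by (cases x) (simp_all add: swap_letter_def)
  then show ?thesis by (simp add: map_idI)
qed

text \<open>The commutator changes sign while the end letters are exchanged, so the two sign
  conditions turn into each other.\<close>

lemma good_pair_swap:
  assumes "good_pair B"
  shows "good_pair (swap_pair B)"
proof -
  have C: "commutator (swap_pair B) = - commutator B"
    by (simp add: commutator_def swap_pair_def)
  have neg: "trace (- M ** N) = - trace (M ** N)" "det (- M) = det M" for M N :: "real^2^2"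
    by (simp_all add: mat2_simps)
  have ends: "map swap_letter (Zero # u @ [One]) = One # map swap_letter u @ [Zero]"
    "map swap_letter (One # u @ [Zero]) = Zero # map swap_letter u @ [One]" for u
    by (simp_all add: swap_letter_def)
  have "det (swap_pair B x) = 1 \<and> trace (swap_pair B x) \<ge> 2" for x
    using assms by (cases x) (auto simp: swap_pair_def good_pair_def)
  moreover have "2 * trace (swap_pair B One ** swap_pair B Zero)
      \<ge> trace (swap_pair B One) * trace (swap_pair B Zero)"
    using assms trace_mul_sym[of "B One" "B Zero"]
    by (simp add: swap_pair_def good_pair_def mult.commute)
  ultimately show ?thesis
    using assms unfolding good_pair_def C neg word_prod_swap_pair ends by auto
qed

section \<open>Desubstitution of words of maximal trace\<close>

lemma not_successively_split:
  "\<not> successively P xs \<Longrightarrow> \<exists>c x y d. xs = c @ [x, y] @ d \<and> \<not> P x y"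
proof (induction xs rule: induct_list012)
  case (3 x y zs)
  show ?case
  proof (cases "P x y")
    case True
    then obtain c u v d where "y # zs = c @ [u, v] @ d" "\<not> P u v"
      using 3 by auto
    then have "x # y # zs = (x # c) @ [u, v] @ d" "\<not> P u v"
      by simp_all
    then show ?thesis by blast
  next
    case False
    have "x # y # zs = [] @ [x, y] @ zs" by simp
    with False show ?thesis by blast
  qed
qed simp_all

text \<open>Every \<open>Zero\<close> except an initial one is preceded by a \<open>One\<close> of
  its own.\<close>

lemma count_zero_le:
  assumes "successively (\<lambda>x y. x = One \<or> y = One) u"
  shows "count_list u Zero \<le> count_list u One + of_bool (u \<noteq> [] \<and> hd u = Zero)"
  using assms
proof (induction u rule: induct_list012)
  case (2 x) then show ?case by (cases x) auto
next
  case (3 x y zs) then show ?case by (cases x; cases y) auto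
qed simp

lemma count_list_fold:
  "count_list (concat (map fold_word u)) Zero = count_list u Zero + count_list u One"
  "count_list (concat (map fold_word u)) One = count_list u One"
proof (induction u)
  case (Cons x u)
  { case 1 show ?case using Cons by (cases x) (simp_all add: fold_word_def) }
  { case 2 show ?case using Cons by (cases x) (simp_all add: fold_word_def) }
qed simp_all

text \<open>Greedy parsing from the left: a \<open>Zero\<close> followed by \<open>One\<close> is
  read as the image of \<open>One\<close>, any other \<open>Zero\<close> as the image of
  \<open>Zero\<close>.\<close>

lemma unfold_word:
  assumes "successively (\<lambda>x y. x = Zero \<or> y = Zero) u" "u \<noteq> [] \<Longrightarrow> hd u = Zero"
  shows "\<exists>v. u = concat (map fold_word v)"
  using assms
proof (induction u rule: length_induct)
  case (1 u)
  show ?case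
  proof (cases u)
    case Nil
    then have "u = concat (map fold_word [])" by simp
    then show ?thesis by blast
  next
    case (Cons x t)
    then have x: "x = Zero" using 1 by simp
    show ?thesis
    proof (cases "t \<noteq> [] \<and> hd t = One")
      case True
      then obtain t' where t: "t = One # t'" by (cases t) auto
      have "successively (\<lambda>x y. x = Zero \<or> y = Zero) t'" "t' \<noteq> [] \<Longrightarrow> hd t' = Zero"
        using 1(2) Cons t by (cases t'; auto)+
      moreover have "length t' < length u" using Cons t by simp
      ultimately obtain v where "t' = concat (map fold_word v)"
        using 1(1) by blast
      then have "u = concat (map fold_word (One # v))"
        using Cons t x by (simp add: fold_word_def)
      then show ?thesis by blast
    next
      case False
      then have "t \<noteq> [] \<Longrightarrow> hd t = Zero" by (cases "hd t") auto
      moreover have "successively (\<lambda>x y. x = Zero \<or> y = Zero) t"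
        using 1(2) Cons by (cases t) auto
      moreover have "length t < length u" using Cons by simp
      ultimately obtain v where "t = concat (map fold_word v)"
        using 1(1) by blast
      then have "u = concat (map fold_word (Zero # v))"
        using Cons x by (simp add: fold_word_def)
      then show ?thesis by blast
    qed
  qed
qed

lemma length_count_list: "length u = count_list u Zero + count_list u One"
proof (induction u)
  case (Cons x u) then show ?case by (cases x) simp_all
qed simp

lemma finite_words: "finite {u :: letter list. length u = n}"
proof -
  have U: "(UNIV :: letter set) = {Zero, One}"
    using letter.exhaust by auto
  have "finite (UNIV :: letter set)" unfolding U by simp
  from finite_lists_length_eq[OF this, of n] show ?thesis by simp
qed

text \<open>A word of maximal trace has no cyclic factor \<open>One One\<close>: by cardinality it would also have a
  cyclic factor \<open>Zero Zero\<close>, and reversing the arc between the two would increase the trace.\<close>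

lemma trace_le_fold_pair:
  assumes good: "good_pair B" and le: "count_list u One \<le> count_list u Zero"
  obtains v where "count_list v Zero = count_list u Zero - count_list u One"
    "count_list v One = count_list u One"
    "trace (word_prod B u) \<le> trace (word_prod (fold_pair B) v)"
proof -
  define S where "S = {w. count_list w Zero = count_list u Zero \<and> count_list w One = count_list u One}"
  have "S \<subseteq> {w. length w = length u}"
    unfolding S_def using length_count_list by auto
  then have fin: "finite S"
    using finite_words finite_subset by blast
  have "u \<in> S" by (simp add: S_def)
  define f where "f = (\<lambda>w. trace (word_prod B w))"
  have "Max (f ` S) \<in> f ` S"
    using fin \<open>u \<in> S\<close> by (intro Max_in) auto
  then obtain w0 where "w0 \<in> S" "f w0 = Max (f ` S)"
    by auto
  then have w0: "w0 \<in> S" "\<And>w. w \<in> S \<Longrightarrow> f w \<le> f w0"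
    using fin by auto
  have rot: "x @ y \<in> S \<longleftrightarrow> y @ x \<in> S" "f (x @ y) = f (y @ x)" for x y
    by (auto simp: S_def f_def trace_word_prod_commute)
  \<comment> \<open>Trace and letter counts are invariant under rotation, so the maximizer can be
    rotated to start with \<open>Zero\<close>, as \<open>unfold_word\<close> requires.\<close>
  obtain w where w: "w \<in> S" "\<And>v. v \<in> S \<Longrightarrow> f v \<le> f w" "w \<noteq> [] \<Longrightarrow> hd w = Zero"
  proof (cases "Zero \<in> set w0")
    case True
    then obtain x y where "w0 = x @ Zero # y" by (meson split_list)
    with w0 rot[of x "Zero # y"] that[of "(Zero # y) @ x"] show ?thesis by auto
  next
    case False
    then have "length w0 = 0"
      using le w0(1) by (auto simp: length_count_list S_def count_list_0_iff)
    then show ?thesis using that w0 by blast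
  qed
  have "successively (\<lambda>x y. x = Zero \<or> y = Zero) w"
  proof (rule ccontr)
    assume "\<not> ?thesis"
    then obtain x y p q where pq: "w = x @ [p, q] @ y" "\<not> (p = Zero \<or> q = Zero)"
      using not_successively_split by blast
    then have "p = One" "q = One" by (metis letter.exhaust)+
    with pq have weq: "w = x @ [One, One] @ y" by simp
    have "[One, One] @ (y @ x) \<in> S" "f ([One, One] @ (y @ x)) = f w"
      using rot[of x "[One, One] @ y"] w(1) weq by simp_all
    note 11 = this
    \<comment> \<open>The remainder \<open>y @ x\<close> has two \<open>One\<close> fewer than
      \<open>w\<close>, hence at least two more \<open>Zero\<close> than \<open>One\<close>;
      \<open>count_zero_le\<close> excludes this for a word without
      \<open>Zero Zero\<close>.\<close>
    have "\<not> successively (\<lambda>x y. x = One \<or> y = One) (y @ x)"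
    proof
      assume "successively (\<lambda>x y. x = One \<or> y = One) (y @ x)"
      from count_zero_le[OF this] 11(1) le show False
        by (auto simp: S_def of_bool_def split: if_splits)
    qed
    then obtain c p q d where pq: "y @ x = c @ [p, q] @ d" "\<not> (p = One \<or> q = One)"
      using not_successively_split by blast
    then have "p = Zero" "q = Zero" by (metis letter.exhaust)+
    with pq have yx: "y @ x = c @ [Zero, Zero] @ d" by simp
    \<comment> \<open>The cuts lie between the two \<open>One\<close> and between the two
      \<open>Zero\<close>. The arcs \<open>U\<close> and \<open>M\<close> then have opposite end
      letters, so their commutator traces have opposite signs and reversing \<open>U\<close>
      increases the trace.\<close>
    define U M where "U = One # c @ [Zero]" and "M = Zero # d @ [One]"
    have UM: "U @ M \<in> S" "f (U @ M) = f w"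
      using rot[of "[One]" "U @ Zero # d"] 11 unfolding yx U_def M_def by simp_all
    have "rev U @ M \<in> S"
      using UM(1) by (simp add: S_def count_list_rev)
    then have "f (rev U @ M) \<le> f w" by (rule w(2))
    moreover have "f (rev U @ M) = f (U @ M)
        - trace (commutator B ** word_prod B U) * trace (commutator B ** word_prod B M)"
      using trace_word_prod_rev[of B U "word_prod B M"] good
      by (simp add: f_def word_prod_append good_pair_def trace_mul_sym[of "word_prod B M"])
    moreover have "trace (commutator B ** word_prod B U) * trace (commutator B ** word_prod B M) < 0"
      using good unfolding U_def M_def good_pair_def by (intro mult_neg_pos) auto
    ultimately show False using UM(2) by simp
  qed
  from unfold_word[OF this w(3)] obtain v where v: "w = concat (map fold_word v)" by blast
  show ?thesis
  proof
    show "count_list v One = count_list u One"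
      using w(1) unfolding S_def v by (simp add: count_list_fold)
    show "count_list v Zero = count_list u Zero - count_list u One"
      using w(1) unfolding S_def v by (auto simp: count_list_fold)
    show "trace (word_prod B u) \<le> trace (word_prod (fold_pair B) v)"
      using w(2)[OF \<open>u \<in> S\<close>] unfolding f_def word_prod_fold_pair v by simp
  qed
qed

section \<open>Spectral radii and the Fricke identity\<close>

definition dominant_root :: "real \<Rightarrow> real" where
  "dominant_root t = (t + sqrt (t\<^sup>2 - 4)) / 2"

lemma dominant_root:
  assumes "t \<ge> 2"
  shows "dominant_root t \<ge> 1" "dominant_root t + 1 / dominant_root t = t"
proof -
  have t: "t\<^sup>2 - 4 \<ge> 0"
    using power_mono[OF assms, of 2] by simp
  then have "2 + 0 \<le> t + sqrt (t\<^sup>2 - 4)"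
    using assms by (intro add_mono) auto
  then show 1: "dominant_root t \<ge> 1"
    unfolding dominant_root_def by simp
  have "dominant_root t * dominant_root t + 1 = t * dominant_root t"
    using real_sqrt_pow2[OF t] unfolding dominant_root_def
    by (simp add: field_simps power2_eq_square)
  then show "dominant_root t + 1 / dominant_root t = t"
    using 1 by (simp add: field_simps)
qed

text \<open>A nonzero row of N - c, turned by a right angle, is an eigenvector; if both rows vanish,
  every nonzero vector is one.\<close>

lemma eigenvalue_iff_mat2:
  fixes N :: "complex^2^2"
  shows "(\<exists>v. v \<noteq> 0 \<and> N *v v = c *s v) \<longleftrightarrow> (N$1$1 - c) * (N$2$2 - c) = N$1$2 * N$2$1"
proof -
  have eq: "N *v v = c *s v \<longleftrightarrow> N$1$1 * v$1 + N$1$2 * v$2 = c * v$1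
      \<and> N$2$1 * v$1 + N$2$2 * v$2 = c * v$2" for v
    by (simp add: matrix_vector_mult_def vec_eq_iff forall_2 sum_2 vector_scalar_mult_def)
  have nz: "v \<noteq> 0 \<longleftrightarrow> v$1 \<noteq> 0 \<or> v$2 \<noteq> 0" for v :: "complex^2"
    by (auto simp: vec_eq_iff forall_2)
  show ?thesis
  proof
    assume "\<exists>v. v \<noteq> 0 \<and> N *v v = c *s v"
    then obtain v :: "complex^2" where v: "v$1 \<noteq> 0 \<or> v$2 \<noteq> 0"
      "N$1$1 * v$1 + N$1$2 * v$2 = c * v$1" "N$2$1 * v$1 + N$2$2 * v$2 = c * v$2"
      using eq nz by auto
    define D where "D = (N$1$1 - c) * (N$2$2 - c) - N$1$2 * N$2$1"
    have "D * v$1 = 0" "D * v$2 = 0"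
      using v(2,3) unfolding D_def by algebra+
    with v(1) show "(N$1$1 - c) * (N$2$2 - c) = N$1$2 * N$2$1"
      by (auto simp: D_def)
  next
    assume D: "(N$1$1 - c) * (N$2$2 - c) = N$1$2 * N$2$1"
    show "\<exists>v. v \<noteq> 0 \<and> N *v v = c *s v"
    proof (cases "N$1$2 = 0 \<and> N$1$1 = c")
      case False
      define v where "v = (vector [N$1$2, c - N$1$1] :: complex^2)"
      have v: "v$1 = N$1$2" "v$2 = c - N$1$1" by (simp_all add: v_def)
      have "v \<noteq> 0 \<and> N *v v = c *s v"
        unfolding eq nz v using False D by (auto simp: algebra_simps)
      then show ?thesis by blast
    next
      case 1: True
      show ?thesis
      proof (cases "N$2$1 = 0 \<and> N$2$2 = c")
        case False
        define v where "v = (vector [c - N$2$2, N$2$1] :: complex^2)"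
        have v: "v$1 = c - N$2$2" "v$2 = N$2$1" by (simp_all add: v_def)
        have "v \<noteq> 0 \<and> N *v v = c *s v"
          unfolding eq nz v using False 1 D by (auto simp: algebra_simps)
        then show ?thesis by blast
      next
        case True
        define v where "v = (vector [1, 0] :: complex^2)"
        have v: "v$1 = 1" "v$2 = 0" by (simp_all add: v_def)
        have "v \<noteq> 0 \<and> N *v v = c *s v"
          unfolding eq nz v using True 1 D by (auto simp: algebra_simps)
        then show ?thesis by blast
      qed
    qed
  qed
qed

lemma spectral_radius_mat2:
  fixes M :: "real^2^2"
  assumes "det M = 1" "trace M \<ge> 2"
  shows "spectral_radius M = dominant_root (trace M)"
proof -
  define s where "s = dominant_root (trace M)"
  have s: "s \<ge> 1" "s + 1 / s = trace M"
    using dominant_root[OF assms(2)] by (auto simp: s_def)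
  have char: "(complex_of_real (M$1$1) - c) * (complex_of_real (M$2$2) - c)
      = complex_of_real (M$1$2) * complex_of_real (M$2$1)
    \<longleftrightarrow> c = complex_of_real s \<or> c = complex_of_real (1 / s)" for c
  proof -
    have "complex_of_real (M$1$1) * complex_of_real (M$2$2)
        - complex_of_real (M$1$2) * complex_of_real (M$2$1) = 1"
      using assms(1) by (simp add: det_2 flip: of_real_mult of_real_diff)
    moreover have "complex_of_real (M$1$1) + complex_of_real (M$2$2)
        = complex_of_real s + complex_of_real (1 / s)"
      using s(2) by (simp only: trace_def sum_2 flip: of_real_add)
    moreover have "complex_of_real s * complex_of_real (1 / s) = 1"
      using s(1) by simp
    ultimately have "(complex_of_real (M$1$1) - c) * (complex_of_real (M$2$2) - c)
      - complex_of_real (M$1$2) * complex_of_real (M$2$1)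
      = (c - complex_of_real s) * (c - complex_of_real (1 / s))"
      by algebra
    then show ?thesis
      by (metis eq_iff_diff_eq_0 mult_eq_0_iff)
  qed
  have "{c. \<exists>v. v \<noteq> 0 \<and> map_matrix complex_of_real M *v v = c *s v}
      = {complex_of_real s, complex_of_real (1 / s)}"
    unfolding eigenvalue_iff_mat2 by (auto simp: char simp del: of_real_divide)
  then have "spectral_radius M = Max {s, 1 / s}"
    using s(1) by (simp add: spectral_radius_def norm_divide)
  also have "\<dots> = s"
  proof -
    have "1 / s \<le> 1" using s(1) by simp
    then have "1 / s \<le> s" using s(1) by (rule order_trans)
    then show ?thesis by simp
  qed
  finally show ?thesis by (simp add: s_def)
qed

lemma spectral_radius_sum_inverse:
  fixes M :: "real^2^2"
  assumes "det M = 1" "trace M \<ge> 2"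
  shows "spectral_radius M \<ge> 1" "spectral_radius M + 1 / spectral_radius M = trace M"
  using dominant_root[OF assms(2)] by (simp_all add: spectral_radius_mat2[OF assms])

lemma word_power_Suc: "word_power u (Suc k) = u @ word_power u k"
  by (simp add: word_power_def)

lemma word_power_0: "word_power u 0 = []"
  by (simp add: word_power_def)

lemma count_list_word_power: "count_list (word_power u k) x = k * count_list u x"
  by (induction k) (simp_all add: word_power_Suc word_power_0)

lemma length_word_power: "length (word_power u k) = k * length u"
  by (induction k) (simp_all add: word_power_Suc word_power_0)

text \<open>The trace of the k-th power is s^k + s^(-k). The Cayley-Hamilton recursion gives this
  also for s = 1, where the matrix need not be diagonalizable.\<close>

lemma trace_word_prod_power:
  fixes B :: "letter \<Rightarrow> real^2^2"
  assumes "det (word_prod B u) = 1" "trace (word_prod B u) \<ge> 2"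
  shows "trace (word_prod B (word_power u k)) \<ge> spectral_radius (word_prod B u) ^ k"
proof -
  define s where "s = spectral_radius (word_prod B u)"
  have s: "s \<ge> 1" "s + 1 / s = trace (word_prod B u)"
    using spectral_radius_sum_inverse[OF assms] by (auto simp: s_def)
  have CH: "trace (X ** M ** M) = trace M * trace (X ** M) - det M * trace X" for X M :: "real^2^2"
    by (simp add: mat2_simps algebra_simps)
  have "trace (word_prod B (word_power u k)) = s ^ k + (1 / s) ^ k"
  proof (induction k rule: induct_nat_012)
    case 0 show ?case by (simp add: word_power_0 mat2_simps)
  next
    case 1 show ?case using s by (simp add: word_power_Suc word_power_0)
  next
    case (ge2 k)
    have "trace (word_prod B (word_power u (Suc (Suc k))))
        = (s + 1 / s) * (s ^ Suc k + (1 / s) ^ Suc k) - (s ^ k + (1 / s) ^ k)"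
      using ge2 CH[of "word_prod B (word_power u k)" "word_prod B u"] s(2) assms(1)
      by (simp add: word_power_Suc word_prod_append)
    also have "\<dots> = s ^ Suc (Suc k) + (1 / s) ^ Suc (Suc k)
        + (s * (1 / s) - 1) * (s ^ k + (1 / s) ^ k)"
      by (simp only: power_Suc) algebra
    finally show ?case using s(1) by simp
  qed
  then show ?thesis using s(1) by (simp add: s_def)
qed

text \<open>With the traces written as x = p + 1/p, y = q + 1/q, z = R + 1/R, the Fricke identity
  becomes (2 z - x y)^2 = d^2 + 4 for d = (p - 1/p) (q - 1/q). The value 2 z - x y = d would mean
  exactly R = p q, so the term 4 measures the failure of multiplicativity.\<close>

lemma good_pair_spectral_radius:
  assumes good: "good_pair B"
  defines "\<rho> \<equiv> \<lambda>x. spectral_radius (B x)"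
  defines "R \<equiv> spectral_radius (B One ** B Zero)"
  shows "\<rho> One * \<rho> Zero \<le> R"
    and "\<rho> One * \<rho> Zero \<ge> 2 \<Longrightarrow> ln R - ln (\<rho> One) - ln (\<rho> Zero) \<le> 4 / 3 / (\<rho> One * \<rho> Zero)"
proof -
  have det1: "det (B x) = 1" and tr2: "trace (B x) \<ge> 2" and detc: "det (commutator B) = -1"
    and z2: "2 * trace (B One ** B Zero) \<ge> trace (B One) * trace (B Zero)" for x
    using good by (auto simp: good_pair_def)
  have prod4: "trace (B One) * trace (B Zero) \<ge> 2 * 2"
    using tr2 by (intro mult_mono) (auto intro: order_trans[OF _ tr2])
  define x y z where "x = trace (B One)" and "y = trace (B Zero)" and "z = trace (B One ** B Zero)"
  define p q where "p = \<rho> One" and "q = \<rho> Zero"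
  have p: "p \<ge> 1" "p + 1 / p = x" and q: "q \<ge> 1" "q + 1 / q = y"
    using spectral_radius_sum_inverse[OF det1 tr2]
    by (auto simp: p_def q_def x_def y_def \<rho>_def)
  have R: "R \<ge> 1" "R + 1 / R = z"
    using spectral_radius_sum_inverse[of "B One ** B Zero"] z2 prod4
    by (auto simp: R_def z_def det_mul det1)
  have fricke: "- 1 = 4 + x * y * z - x\<^sup>2 - y\<^sup>2 - z\<^sup>2"
    using det_commutator[of B] detc det1 by (simp add: x_def y_def z_def)
  define d where "d = (p - 1 / p) * (q - 1 / q)"
  have "p - 1 / p \<ge> 0" "q - 1 / q \<ge> 0"
    using p(1) q(1) by (auto simp: field_simps intro: order_trans[OF _ mult_mono[of 1 _ 1]])
  then have d0: "d \<ge> 0" by (simp add: d_def)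
  have inv: "p * (1 / p) = 1" "q * (1 / q) = 1" using p(1) q(1) by auto
  have d2: "(2 * z - x * y)\<^sup>2 = d\<^sup>2 + 4"
    using fricke inv unfolding d_def p(2)[symmetric] q(2)[symmetric] by algebra
  define r where "r = p * q"
  have r1: "r \<ge> 1"
    using p(1) q(1) mult_mono[of 1 p 1 q] by (simp add: r_def)
  have rd: "2 * (r + 1 / r) = x * y + d"
    using inv p(1) q(1) unfolding r_def d_def p(2)[symmetric] q(2)[symmetric]
    by (simp add: field_simps)
  have nn: "2 * z - x * y \<ge> 0" using z2 by (simp add: x_def y_def z_def)
  \<comment> \<open>The value 2 z - x y lies between d and d + 2, so \<open>R + 1 / R\<close>
    exceeds \<open>r + 1 / r\<close> by at least 0 and at most 1.\<close>
  have lo: "d \<le> 2 * z - x * y"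
    by (rule power2_le_imp_le[OF _ nn]) (simp add: d2)
  have hi: "2 * z - x * y \<le> d + 2"
    by (rule power2_le_imp_le) (use d0 in \<open>simp_all add: d2 power2_sum\<close>)
  have diff: "(R + 1 / R) - (r + 1 / r) = (R - r) * (1 - 1 / (R * r))"
    using R(1) r1 by (simp add: field_simps)
  have ge: "(R - r) * (1 - 1 / (R * r)) \<ge> 0" and le: "(R - r) * (1 - 1 / (R * r)) \<le> 1"
    using lo hi rd R(2) diff by auto
  have rR: "r \<le> R"
  proof (rule ccontr)
    assume "\<not> r \<le> R"
    then have "1 < R * r" using R(1) r1 mult_mono[of 1 R 1 r]
      by (smt (verit) mult_less_cancel_right2 mult_le_cancel_right2)
    then have "1 - 1 / (R * r) > 0" by simp
    with ge \<open>\<not> r \<le> R\<close> show False by (simp add: zero_le_mult_iff)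
  qed
  then show "\<rho> One * \<rho> Zero \<le> R" by (simp add: r_def p_def q_def)
  assume "\<rho> One * \<rho> Zero \<ge> 2"
  then have r2: "r \<ge> 2" by (simp add: r_def p_def q_def)
  \<comment> \<open>This makes the factor \<open>1 - 1 / (R * r)\<close> at least 3 / 4, the source
    of the constant 4 / 3.\<close>
  have "R * r \<ge> 2 * 2" using r2 rR by (intro mult_mono) auto
  then have "1 - 1 / (R * r) \<ge> 3 / 4" by (simp add: field_simps)
  then have "(R - r) * (3 / 4) \<le> (R - r) * (1 - 1 / (R * r))"
    using rR by (intro mult_left_mono) auto
  then have "(R - r) * (3 / 4) \<le> 1" using le by (rule order_trans)
  then have "R - r \<le> 4 / 3" by simp
  have "ln R - ln (\<rho> One) - ln (\<rho> Zero) = ln (R / r)"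
    using R(1) p(1) q(1) by (simp add: r_def ln_div ln_mult p_def[symmetric] q_def[symmetric])
  also have "\<dots> \<le> R / r - 1" using R(1) r1 by (intro ln_le_minus_one) simp
  also have "\<dots> = (R - r) / r" using r1 by (simp add: field_simps)
  also have "\<dots> \<le> 4 / 3 / r" using \<open>R - r \<le> 4 / 3\<close> r1 by (intro divide_right_mono) auto
  finally show "ln R - ln (\<rho> One) - ln (\<rho> Zero) \<le> 4 / 3 / (\<rho> One * \<rho> Zero)"
    by (simp add: r_def p_def q_def)
qed

lemma good_pair_funpow_fold: "good_pair B \<Longrightarrow> good_pair ((fold_pair ^^ n) B)"
  by (induction n) (simp_all add: good_pair_fold)

lemma funpow_fold_pair_Zero: "(fold_pair ^^ n) B Zero = B Zero"
  by (induction n) (simp_all add: fold_pair_def)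

lemma good_pair_spectral_radius_ge_1: "good_pair B \<Longrightarrow> spectral_radius (B x) \<ge> 1"
  by (rule spectral_radius_sum_inverse) (auto simp: good_pair_def)

lemma funpow_fold_spectral_radius_ge:
  assumes good: "good_pair B"
  shows "spectral_radius ((fold_pair ^^ n) B One)
    \<ge> spectral_radius (B Zero) ^ n * spectral_radius (B One)"
proof (induction n)
  case (Suc n)
  have "spectral_radius (B Zero) ^ Suc n * spectral_radius (B One)
      = (spectral_radius (B Zero) ^ n * spectral_radius (B One)) * spectral_radius (B Zero)"
    by (simp add: mult_ac)
  also have "\<dots> \<le> spectral_radius ((fold_pair ^^ n) B One) * spectral_radius (B Zero)"
    using Suc good_pair_spectral_radius_ge_1[OF good, of Zero] by (intro mult_right_mono) auto
  also have "\<dots> \<le> spectral_radius ((fold_pair ^^ Suc n) B One)"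
    using good_pair_spectral_radius(1)[OF good_pair_funpow_fold[OF good, of n]]
    by (simp add: funpow_fold_pair_Zero fold_pair_def)
  finally show ?case .
qed simp

text \<open>Each fold costs at most 4 / 3 divided by the product of the current radii. As
  \<open>p\<close> is at least 2, the lower bound for that product doubles with each fold, and the
  costs sum as a geometric series below twice the first one.\<close>

lemma funpow_fold_spectral_radius_le:
  assumes good: "good_pair B" and ge2: "spectral_radius (B Zero) \<ge> 2"
  defines "p \<equiv> spectral_radius (B Zero)" and "q \<equiv> spectral_radius (B One)"
  shows "ln (spectral_radius ((fold_pair ^^ n) B One)) - real n * ln p - ln q
    \<le> 8 / 3 / (p * q) * (1 - (1 / 2) ^ n)"
proof (induction n)
  case 0 show ?case by (simp add: q_def)
next
  case (Suc n)
  define R where "R = (\<lambda>n. spectral_radius ((fold_pair ^^ n) B One))"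
  have p2: "p \<ge> 2" and q1: "q \<ge> 1"
    using ge2 good_pair_spectral_radius_ge_1[OF good] by (auto simp: p_def q_def)
  have "2 ^ n * q \<le> p ^ n * q"
    using p2 q1 by (intro mult_right_mono power_mono) auto
  also have "\<dots> \<le> R n"
    using funpow_fold_spectral_radius_ge[OF good, of n] by (simp add: R_def p_def q_def)
  finally have Rn: "2 ^ n * (p * q) \<le> R n * p"
    using p2 mult_right_mono[of "2 ^ n * q" "R n" p] by (simp add: mult_ac)
  have "2 \<le> p * q" using p2 q1 mult_mono[of 2 p 1 q] by simp
  moreover have "p * q \<le> 2 ^ n * (p * q)"
    using p2 q1 mult_right_mono[of 1 "2 ^ n" "p * q"] by simp
  ultimately have "2 \<le> R n * p" using Rn by linarith
  then have "ln (R (Suc n)) - ln (R n) - ln p \<le> 4 / 3 / (R n * p)"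
    using good_pair_spectral_radius(2)[OF good_pair_funpow_fold[OF good, of n]]
    by (simp add: R_def p_def funpow_fold_pair_Zero fold_pair_def)
  also have "\<dots> \<le> 4 / 3 / (2 ^ n * (p * q))"
  proof (rule divide_left_mono)
    have *: "0 < 2 ^ n * (p * q)" using p2 q1 by simp
    then show "0 < (R n * p) * (2 ^ n * (p * q))"
      by (rule mult_pos_pos[OF less_le_trans[OF _ Rn]]) (rule *)
  qed (use Rn in auto)
  finally have "ln (R (Suc n)) - ln (R n) - ln p \<le> 4 / 3 / (2 ^ n * (p * q))" .
  moreover have "8 / 3 / (p * q) * (1 - (1 / 2) ^ n) + 4 / 3 / (2 ^ n * (p * q))
      = 8 / 3 / (p * q) * (1 - (1 / 2) ^ Suc n)"
    using p2 q1 by (simp add: field_simps)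
  ultimately show ?case
    using Suc by (simp add: R_def algebra_simps)
qed

text \<open>Each desubstitution removes \<open>l\<close> letters \<open>Zero\<close>; starting from
  \<open>m + n * l\<close> of them, the \<open>One\<close> never outnumber the \<open>Zero\<close>
  in the n steps.\<close>

lemma trace_le_funpow_fold:
  assumes "good_pair B" "count_list u Zero = m + n * l" "count_list u One = l"
  shows "\<exists>v. count_list v Zero = m \<and> count_list v One = l \<and>
    trace (word_prod B u) \<le> trace (word_prod ((fold_pair ^^ n) B) v)"
  using assms
proof (induction n arbitrary: m)
  case 0 then show ?case by auto
next
  case (Suc n)
  then obtain v where v: "count_list v Zero = m + l" "count_list v One = l"
    "trace (word_prod B u) \<le> trace (word_prod ((fold_pair ^^ n) B) v)"
    using Suc.IH[of "m + l"] by (auto simp: algebra_simps)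
  obtain v' where "count_list v' Zero = m" "count_list v' One = l"
    "trace (word_prod ((fold_pair ^^ n) B) v) \<le> trace (word_prod (fold_pair ((fold_pair ^^ n) B)) v')"
    using trace_le_fold_pair[OF good_pair_funpow_fold[OF Suc.prems(1), of n], of v] v by auto
  with v show ?case by (intro exI[of _ v']) auto
qed

section \<open>The matrices of the standard words\<close>

lemma A_mat_component:
  "A_mat Zero $1$1 = 1" "A_mat Zero $1$2 = 1" "A_mat Zero $2$1 = 0" "A_mat Zero $2$2 = 1"
  "A_mat One $1$1 = 1" "A_mat One $1$2 = 0" "A_mat One $2$1 = 1" "A_mat One $2$2 = 1"
  by simp_all

definition nonneg_mat :: "real^'n^'m \<Rightarrow> bool" where
  "nonneg_mat M \<longleftrightarrow> (\<forall>i j. M$i$j \<ge> 0)"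

definition entry_sum :: "real^2^2 \<Rightarrow> real" where
  "entry_sum M = M$1$1 + M$1$2 + M$2$1 + M$2$2"

lemma nonneg_mat2: "nonneg_mat (M :: real^2^2) \<longleftrightarrow> M$1$1 \<ge> 0 \<and> M$1$2 \<ge> 0 \<and> M$2$1 \<ge> 0 \<and> M$2$2 \<ge> 0"
  by (auto simp: nonneg_mat_def forall_2)

lemma nonneg_word_prod:
  fixes B :: "letter \<Rightarrow> real^'n^'n"
  assumes "\<And>x. nonneg_mat (B x)"
  shows "nonneg_mat (word_prod B u)"
proof (induction u)
  case Nil show ?case by (simp add: nonneg_mat_def mat_def)
next
  case (Cons x u)
  then show ?case
    using assms by (auto simp: nonneg_mat_def matrix_matrix_mult_def intro!: sum_nonneg)
qed

lemma nonneg_A_mat: "nonneg_mat (A_mat x)"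
  by (cases x) (auto simp: nonneg_mat2 A_mat_component simp del: A_mat.simps)

lemma nonneg_word_prod_A_mat: "nonneg_mat (word_prod A_mat u)"
  by (rule nonneg_word_prod[OF nonneg_A_mat])

lemma det_word_prod_A_mat: "det (word_prod A_mat u) = 1"
proof (induction u)
  case (Cons x u)
  have "det (A_mat x) = 1" by (cases x) (simp_all add: det_2)
  with Cons show ?case by (simp add: det_mul)
qed simp

lemma entry_sum_mult_le:
  assumes "nonneg_mat M" "nonneg_mat N"
  shows "entry_sum (M ** N) \<le> entry_sum M * entry_sum N"
  using assms unfolding nonneg_mat2
  by (simp add: entry_sum_def mat2_simps algebra_simps)

lemma entry_sum_nonneg: "nonneg_mat M \<Longrightarrow> entry_sum M \<ge> 0"
  by (simp add: nonneg_mat2 entry_sum_def)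

lemma trace_le_entry_sum: "nonneg_mat (M :: real^2^2) \<Longrightarrow> trace M \<le> entry_sum M"
  by (simp add: nonneg_mat2 entry_sum_def trace_def sum_2)

text \<open>On nonnegative matrices the entry sum is submultiplicative and dominates the trace; the
  factor 2 is the entry sum of the identity.\<close>

lemma trace_word_prod_le:
  fixes B :: "letter \<Rightarrow> real^2^2"
  assumes "\<And>x. nonneg_mat (B x)"
  shows "trace (word_prod B u)
    \<le> 2 * (entry_sum (B Zero) ^ count_list u Zero * entry_sum (B One) ^ count_list u One)"
proof -
  have "entry_sum (word_prod B u)
      \<le> 2 * (entry_sum (B Zero) ^ count_list u Zero * entry_sum (B One) ^ count_list u One)"
  proof (induction u)
    case Nil show ?case by (simp add: entry_sum_def mat_def)
  next
    case (Cons x u)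
    have "entry_sum (word_prod B (x # u)) \<le> entry_sum (word_prod B u) * entry_sum (B x)"
      using entry_sum_mult_le[OF nonneg_word_prod[OF assms] assms] by simp
    also have "\<dots> \<le> 2 * (entry_sum (B Zero) ^ count_list u Zero * entry_sum (B One) ^ count_list u One)
        * entry_sum (B x)"
      using Cons entry_sum_nonneg[OF assms] by (intro mult_right_mono) auto
    finally show ?case by (cases x) (simp_all add: mult_ac)
  qed
  with trace_le_entry_sum[OF nonneg_word_prod[of B u, OF assms]] show ?thesis
    by (rule order_trans)
qed

text \<open>The second row of \<open>A_mat One\<close> and the second column of
  \<open>A_mat Zero\<close> consist of ones. Padding a word thus turns a norm into a diagonal entry,
  which is bounded by a trace and is supermultiplicative.\<close>

lemma component22_zero_one:
  "word_prod A_mat (Zero # u @ [One]) $2$2 = entry_sum (word_prod A_mat u)"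
  by (simp add: word_prod_append entry_sum_def mat2_simps)

lemma good_pair_A_mat: "good_pair A_mat"
proof -
  \<comment> \<open>The commutator is the diagonal matrix with entries -1 and 1.\<close>
  have tr: "trace (commutator A_mat ** M) = M$2$2 - M$1$1" for M
    by (simp add: commutator_def mat2_simps algebra_simps)
  have pos: "M$1$2 + M$2$1 + M$2$2 > 0 \<and> M$1$2 + M$2$1 + M$1$1 > 0" if "M = word_prod A_mat u" for M u
  proof -
    have n: "M$1$1 \<ge> 0" "M$1$2 \<ge> 0" "M$2$1 \<ge> 0" "M$2$2 \<ge> 0" "M$1$1 * M$2$2 - M$1$2 * M$2$1 = 1"
      using nonneg_word_prod_A_mat[of u] det_word_prod_A_mat[of u] that
      by (auto simp: nonneg_mat2 det_2)
    then have "M$1$1 * M$2$2 > 0"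
      using mult_nonneg_nonneg[OF n(2) n(3)] by linarith
    then have "M$1$1 > 0" "M$2$2 > 0"
      using n by (auto simp: zero_less_mult_iff)
    with n show ?thesis by linarith
  qed
  have "det (A_mat x) = 1 \<and> trace (A_mat x) \<ge> 2" for x
    by (cases x) (simp_all add: det_2 trace_def sum_2)
  moreover have "det (commutator A_mat) = -1"
    "2 * trace (A_mat One ** A_mat Zero) \<ge> trace (A_mat One) * trace (A_mat Zero)"
    by (simp_all add: commutator_def mat2_simps)
  moreover have "trace (commutator A_mat ** word_prod A_mat (Zero # u @ [One])) > 0"
    "trace (commutator A_mat ** word_prod A_mat (One # u @ [Zero])) < 0" for u
    using pos[OF refl, of u] unfolding tr by (simp_all add: word_prod_append mat2_simps)
  ultimately show ?thesis
    unfolding good_pair_def by blast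
qed

section \<open>Standard words as iterated folds and swaps\<close>

abbreviation sword :: "(nat \<Rightarrow> nat) \<Rightarrow> nat \<Rightarrow> letter list" where
  "sword \<equiv> std_word_shift"

abbreviation smat :: "(nat \<Rightarrow> nat) \<Rightarrow> nat \<Rightarrow> real^2^2" where
  "smat a k \<equiv> word_prod A_mat (sword a k)"

text \<open>Only the first exponent \<open>a 1 - 1\<close> is irregular; with \<open>sexp\<close>
  one recursion, \<open>sword_rec\<close>, covers all words.\<close>

definition sexp :: "(nat \<Rightarrow> nat) \<Rightarrow> nat \<Rightarrow> nat" where
  "sexp a k = (if k = 0 then a 1 - 1 else a (k + 1))"

lemma sword_rec: "sword a (k + 2) = word_power (sword a (k + 1)) (sexp a k) @ sword a k"
  by (cases k) (simp_all add: sexp_def numeral_2_eq_2)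

text \<open>The newer word sits at \<open>Zero\<close>. Starting from \<open>A_mat\<close>, one step
  of the continued fraction consists of \<open>sexp a k\<close> folds followed by a swap
  (\<open>level_Suc\<close>).\<close>

definition level :: "(nat \<Rightarrow> nat) \<Rightarrow> nat \<Rightarrow> letter \<Rightarrow> real^2^2" where
  "level a k = case_letter (smat a (k + 1)) (smat a k)"

lemma funpow_fold_pair_One:
  assumes "B Zero = word_prod A u" "B One = word_prod A v"
  shows "(fold_pair ^^ n) B One = word_prod A (word_power u n @ v)"
proof (induction n)
  case 0 show ?case using assms by (simp add: word_power_0)
next
  case (Suc n)
  have fold: "fold_pair C One = C One ** C Zero" for C
    by (simp add: fold_pair_def)
  show ?case
    using assms Suc by (simp add: fold funpow_fold_pair_Zero word_power_Suc word_prod_append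
        matrix_mul_assoc)
qed

lemma funpow_fold_level_One: "(fold_pair ^^ sexp a k) (level a k) One = smat a (k + 2)"
  unfolding sword_rec by (rule funpow_fold_pair_One) (simp_all add: level_def)

lemma level_Suc: "level a (Suc k) = swap_pair ((fold_pair ^^ sexp a k) (level a k))"
proof
  show "level a (Suc k) x = swap_pair ((fold_pair ^^ sexp a k) (level a k)) x" for x
    using funpow_fold_level_One[of a k]
    by (cases x) (simp_all add: swap_pair_def funpow_fold_pair_Zero, simp_all add: level_def)
qed

lemma level_0: "level a 0 = A_mat"
proof
  show "level a 0 x = A_mat x" for x
    by (cases x) (simp_all add: level_def)
qed

lemma good_pair_level: "good_pair (level a k)"
  by (induction k)
    (simp_all add: level_0 good_pair_A_mat level_Suc good_pair_swap good_pair_funpow_fold)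

text \<open>A word with the letter counts of m copies of one standard word and l of its predecessor
  is replaced, without loss of trace, by an actual product of such copies. In the induction m copies
  of the newest word are split by \<open>sword_rec\<close>, and \<open>trace_le_funpow_fold\<close>
  puts them together again.\<close>

lemma trace_le_level:
  assumes "\<And>x. count_list u x = m * count_list (sword a (k + 1)) x + l * count_list (sword a k) x"
  shows "\<exists>v. count_list v Zero = m \<and> count_list v One = l \<and>
    trace (word_prod A_mat u) \<le> trace (word_prod (level a k) v)"
  using assms
proof (induction k arbitrary: m l)
  case 0
  from 0[of Zero] 0[of One] show ?case
    by (auto simp: level_0)
next
  case (Suc k)
  have "count_list u x = (l + sexp a k * m) * count_list (sword a (k + 1)) x
      + m * count_list (sword a k) x" for x
    using Suc.prems[of x] sword_rec[of a k] by (simp add: count_list_word_power algebra_simps)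
  from Suc.IH[OF this] obtain v where v: "count_list v Zero = l + sexp a k * m"
    "count_list v One = m" "trace (word_prod A_mat u) \<le> trace (word_prod (level a k) v)"
    by blast
  from trace_le_funpow_fold[OF good_pair_level v(1,2)]
  obtain v' where v': "count_list v' Zero = l" "count_list v' One = m"
    "trace (word_prod (level a k) v) \<le> trace (word_prod ((fold_pair ^^ sexp a k) (level a k)) v')"
    by blast
  have "word_prod (level a (Suc k)) (map swap_letter v')
      = word_prod ((fold_pair ^^ sexp a k) (level a k)) v'"
    unfolding level_Suc word_prod_swap_pair map_swap_letter_swap ..
  then show ?case
    using v(3) v' by (intro exI[of _ "map swap_letter v'"]) (auto simp: count_list_swap)
qed

section \<open>Growth of the spectral radii of the standard words\<close>

definition srho :: "(nat \<Rightarrow> nat) \<Rightarrow> nat \<Rightarrow> real" where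
  "srho a k = spectral_radius (smat a k)"

lemma det_trace_smat: "det (smat a k) = 1" "trace (smat a k) \<ge> 2"
  using good_pair_level[of a k] by (auto simp: good_pair_def level_def split: letter.splits)

lemma srho_ge_1: "srho a k \<ge> 1" and srho_trace: "srho a k + 1 / srho a k = trace (smat a k)"
  using spectral_radius_sum_inverse[OF det_trace_smat] by (simp_all add: srho_def)

lemma trace_smat_le: "trace (smat a k) \<le> 2 * srho a k"
proof -
  have "1 / srho a k \<le> 1" using srho_ge_1[of a k] by simp
  then show ?thesis using srho_ge_1[of a k] srho_trace[of a k] by linarith
qed

lemma srho_0: "srho a 0 = 1" "srho a 1 = 1"
proof -
  have *: "s = 1" if "s \<ge> 1" "s + 1 / s = 2" for s :: real
  proof -
    have "(s - 1)\<^sup>2 = s * (s + 1 / s - 2)"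
      using that(1) by (simp add: field_simps power2_eq_square)
    with that show ?thesis by simp
  qed
  show "srho a 0 = 1" "srho a 1 = 1"
    using srho_trace[of a 0] srho_trace[of a 1]
    by (auto intro!: * srho_ge_1 simp: trace_def sum_2)
qed

lemma srho_rec_ge: "srho a (k + 2) \<ge> srho a (k + 1) ^ sexp a k * srho a k"
  using funpow_fold_spectral_radius_ge[OF good_pair_level[of a k], of "sexp a k"]
  unfolding funpow_fold_level_One by (simp add: srho_def level_def)

definition lrho :: "(nat \<Rightarrow> nat) \<Rightarrow> nat \<Rightarrow> real" where
  "lrho a k = ln (srho a k)"

definition defect :: "(nat \<Rightarrow> nat) \<Rightarrow> nat \<Rightarrow> real" where
  "defect a k = lrho a (k + 2) - real (sexp a k) * lrho a (k + 1) - lrho a k"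

lemma defect_nonneg: "defect a k \<ge> 0"
proof -
  have "ln (srho a (k + 1) ^ sexp a k * srho a k) \<le> ln (srho a (k + 2))"
    using srho_rec_ge[of a k] srho_ge_1[of a k] srho_ge_1[of a "k + 1"]
    by (intro ln_mono) (auto intro!: mult_pos_pos zero_less_power)
  then show ?thesis
    using srho_ge_1[of a k] srho_ge_1[of a "k + 1"]
    by (simp add: defect_def lrho_def ln_mult ln_realpow)
qed

lemma defect_le:
  assumes "srho a (k + 1) \<ge> 2"
  shows "defect a k \<le> 8 / 3 / (srho a (k + 1) * srho a k)"
proof -
  have "defect a k \<le> 8 / 3 / (srho a (k + 1) * srho a k) * (1 - (1 / 2) ^ sexp a k)"
    using funpow_fold_spectral_radius_le[OF good_pair_level[of a k], of "sexp a k"] assms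
    unfolding funpow_fold_level_One by (simp add: srho_def level_def defect_def lrho_def)
  also have "\<dots> \<le> 8 / 3 / (srho a (k + 1) * srho a k) * 1"
    using srho_ge_1[of a k] assms by (intro mult_left_mono) auto
  finally show ?thesis by simp
qed

context
  fixes a :: "nat \<Rightarrow> nat"
  assumes a1: "a 1 \<ge> 2" and a_pos: "\<And>i. i \<ge> 1 \<Longrightarrow> a i \<ge> 1"
begin

lemma sexp_ge_1: "sexp a k \<ge> 1"
  using a1 a_pos[of "k + 1"] by (auto simp: sexp_def)

lemma srho_2_ge: "srho a 2 \<ge> 2"
proof -
  have "word_prod A_mat (word_power [Zero] n) = vector [vector [1, real n], vector [0, 1]]" for n
    by (induction n) (simp_all add: word_power_0 word_power_Suc mat2_simps)
  \<comment> \<open>The trace is exactly \<open>a 1 + 1\<close>.\<close>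
  then have "trace (smat a 2) \<ge> 3"
    using a1 by (simp add: numeral_2_eq_2 word_prod_append mat2_simps)
  then have "srho a 2 + 1 / srho a 2 \<ge> 3" by (simp add: srho_trace)
  moreover have "1 / srho a 2 \<le> 1" using srho_ge_1[of a 2] by simp
  ultimately show ?thesis by linarith
qed

lemma srho_Suc_ge: "srho a (k + 2) \<ge> srho a (k + 1) * srho a k"
proof -
  have "srho a (k + 1) ^ 1 \<le> srho a (k + 1) ^ sexp a k"
    using srho_ge_1 sexp_ge_1 by (intro power_increasing) auto
  then have "srho a (k + 1) * srho a k \<le> srho a (k + 1) ^ sexp a k * srho a k"
    using srho_ge_1[of a k] by (intro mult_right_mono) auto
  then show ?thesis using srho_rec_ge[of a k] by linarith
qed

lemma srho_ge_2: "srho a (k + 2) \<ge> 2"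
proof (induction k)
  case 0 show ?case using srho_2_ge by (simp add: numeral_2_eq_2)
next
  case (Suc k)
  have "srho a (k + 2) * 1 \<le> srho a (k + 2) * srho a (k + 1)"
    using srho_ge_1[of a "k + 1"] srho_ge_1[of a "k + 2"] by (intro mult_left_mono) auto
  also have "\<dots> \<le> srho a (Suc k + 2)"
    using srho_Suc_ge[of "k + 1"] by simp
  finally show ?case using Suc by linarith
qed

lemma srho_double: "srho a (k + 4) \<ge> 2 * srho a (k + 3)"
proof -
  have "srho a (k + 3) * 2 \<le> srho a (k + 3) * srho a (k + 2)"
    using srho_ge_1[of a "k + 3"] srho_ge_2[of k] by (intro mult_left_mono) auto
  with srho_Suc_ge[of "k + 2"] show ?thesis by (simp add: numeral_eq_Suc)
qed

text \<open>The first letter comes from the preceding word and the suffix from the word two steps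
  back, so the two possible suffixes alternate. The shape makes the entry sum comparable with the
  trace in \<open>entry_sum_smat_le\<close>.\<close>

lemma sword_shape:
  "\<exists>x. sword a (k + 2) = Zero # x @ [One] \<or> sword a (k + 2) = Zero # x @ [One, Zero]"
proof (induction k rule: less_induct)
  case (less k)
  have power: "\<exists>t. word_power u n = u @ t" if "n \<ge> 1" for u n
    using that by (cases n) (auto simp: word_power_Suc)
  consider "k = 0" | "k = 1" | j where "k = j + 2"
    by (metis One_nat_def add_2_eq_Suc' not0_implies_Suc)
  then show ?case
  proof cases
    case 1
    obtain t where "word_power [Zero] (sexp a 0) = [Zero] @ t"
      using power[OF sexp_ge_1] by blast
    then have "sword a 2 = Zero # t @ [One]"
      by (simp add: numeral_2_eq_2 sexp_def)
    with 1 show ?thesis by (metis add_0)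
  next
    case 2
    obtain s where s: "sexp a 1 = Suc s"
      using sexp_ge_1[of 1] by (cases "sexp a 1") auto
    obtain t where t: "word_power [Zero] (sexp a 0) = [Zero] @ t"
      using power[OF sexp_ge_1] by blast
    have 2: "sword a 2 = Zero # t @ [One]"
      using t by (simp add: numeral_2_eq_2 sexp_def)
    have rot: "word_power (x @ [y]) (Suc n) = word_power (x @ [y]) n @ x @ [y]" for x n and y :: letter
      by (induction n) (simp_all add: word_power_0 word_power_Suc)
    have "sword a 3 = word_power (Zero # t @ [One]) s @ Zero # t @ [One, Zero]"
      using sword_rec[of a 1] rot[of "Zero # t" One s] 2 s by (simp add: numeral_eq_Suc)
    moreover have "\<exists>x. word_power (Zero # t @ [One]) s @ Zero # t @ [One, Zero] = Zero # x @ [One, Zero]"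
      by (cases s) (auto simp: word_power_0 word_power_Suc)
    ultimately show ?thesis using \<open>k = 1\<close> by (auto simp: numeral_eq_Suc)
  next
    case 3
    obtain x where x: "sword a (j + 3) = Zero # x"
      using less[of "j + 1"] 3 by (auto simp: numeral_eq_Suc)
    obtain y where y: "sword a (j + 2) = Zero # y @ [One] \<or> sword a (j + 2) = Zero # y @ [One, Zero]"
      using less[of j] 3 by auto
    obtain t where "word_power (sword a (j + 3)) (sexp a (j + 2)) = Zero # x @ t"
      using power[OF sexp_ge_1[of "j + 2"], of "sword a (j + 3)"] x by auto
    then have "sword a (k + 2) = Zero # (x @ t) @ sword a (j + 2)"
      using sword_rec[of a "j + 2"] 3 by (simp add: numeral_eq_Suc)
    with y show ?thesis
      by (metis append.assoc append_Cons)
  qed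
qed

text \<open>For a word from \<open>Zero\<close> to \<open>One\<close> the entry sum is at most twice
  the trace. A further final \<open>Zero\<close> at most doubles the entry sum and does not lower
  the trace, and the trace is at most twice the spectral radius; together this gives 8.\<close>

lemma entry_sum_smat_le: "entry_sum (smat a (k + 2)) \<le> 8 * srho a (k + 2)"
proof -
  obtain x where x: "sword a (k + 2) = Zero # x @ [One] \<or> sword a (k + 2) = Zero # x @ [One, Zero]"
    using sword_shape by blast
  define N where "N = word_prod A_mat (Zero # x @ [One])"
  have "entry_sum N \<le> 2 * trace N"
    using nonneg_word_prod_A_mat[of x]
    by (simp add: N_def entry_sum_def mat2_simps word_prod_append nonneg_mat2)
  moreover have "nonneg_mat N" unfolding N_def by (rule nonneg_word_prod_A_mat)
  then have "entry_sum (A_mat Zero ** N) \<le> 2 * entry_sum N" "trace N \<le> trace (A_mat Zero ** N)"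
    "entry_sum N \<ge> 0" "trace N \<ge> 0"
    by (auto simp: entry_sum_def mat2_simps nonneg_mat2)
  moreover have "smat a (k + 2) = N \<or> smat a (k + 2) = A_mat Zero ** N"
    using x by (auto simp: N_def word_prod_append matrix_mul_assoc)
  ultimately have "entry_sum (smat a (k + 2)) \<le> 4 * trace (smat a (k + 2))"
    by auto
  with trace_smat_le[of a "k + 2"] show ?thesis by linarith
qed

end

section \<open>Convergents\<close>

fun cf_frac :: "nat list \<Rightarrow> nat \<times> nat" where
  "cf_frac [] = (0, 1)"
| "cf_frac (x # xs) = (snd (cf_frac xs), x * snd (cf_frac xs) + fst (cf_frac xs))"

text \<open>Like \<open>cfrac\<close>, \<open>cf_frac\<close> recurses at the front of the list; the
  usual recursion of convergents works at its end.\<close>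

lemma cf_frac_append:
  "fst (cf_frac (xs @ [x, y])) = y * fst (cf_frac (xs @ [x])) + fst (cf_frac xs)"
  "snd (cf_frac (xs @ [x, y])) = y * snd (cf_frac (xs @ [x])) + snd (cf_frac xs)"
proof (induction xs)
  case (Cons z xs)
  { case 1 show ?case using Cons by simp }
  { case 2 show ?case using Cons by (simp add: algebra_simps) }
qed simp_all

lemma cfrac_eq_cf_frac:
  assumes "\<forall>x\<in>set xs. x \<ge> 1"
  shows "snd (cf_frac xs) \<ge> 1 \<and> coprime (fst (cf_frac xs)) (snd (cf_frac xs)) \<and>
    cfrac xs = of_nat (fst (cf_frac xs)) / of_nat (snd (cf_frac xs))"
  using assms
proof (induction xs)
  case (Cons x xs)
  define n d where "n = fst (cf_frac xs)" and "d = snd (cf_frac xs)"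
  have IH: "d \<ge> 1" "coprime n d" "cfrac xs = of_nat n / of_nat d" and x: "x \<ge> 1"
    using Cons by (auto simp: n_def d_def)
  have "coprime d (x * d + n)"
    using IH(2) by (metis add.commute coprime_commute coprime_iff_gcd_eq_1 gcd_add_mult)
  moreover have "x * d + n \<ge> 1" using IH(1) x by (simp add: Suc_leI)
  moreover have "1 / (of_nat x + of_nat n / of_nat d) = (of_nat d / (of_nat (x * d + n)) :: rat)"
    using IH(1) by (simp add: field_simps)
  ultimately show ?case
    using IH(3) by (simp add: n_def d_def)
qed simp

text \<open>Defining p_n and q_n by letter counts and lengths of s_n makes counts of words directly
  usable; \<open>cf_frac_convergent\<close> identifies them with the convergents.\<close>

definition cfp :: "(nat \<Rightarrow> nat) \<Rightarrow> nat \<Rightarrow> nat" where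
  "cfp a n = count_list (sword a (Suc n)) One"

definition cfq :: "(nat \<Rightarrow> nat) \<Rightarrow> nat \<Rightarrow> nat" where
  "cfq a n = length (sword a (Suc n))"

lemma cfp_simps: "cfp a 0 = 0" "cfp a (Suc 0) = 1"
    "cfp a (n + 2) = a (n + 2) * cfp a (n + 1) + cfp a n"
  using sword_rec[of a "n + 1"]
  by (simp_all add: cfp_def count_list_word_power sexp_def)

lemma cfq_0: "cfq a 0 = 1"
  and cfq_rec: "cfq a (n + 2) = a (n + 2) * cfq a (n + 1) + cfq a n"
  using sword_rec[of a "n + 1"]
  by (simp_all add: cfq_def length_word_power sexp_def)

text \<open>The distance of gamma q_n from p_n; the sign makes it positive
  (\<open>cf_err_pos\<close>).\<close>

definition cf_err :: "(nat \<Rightarrow> nat) \<Rightarrow> real \<Rightarrow> nat \<Rightarrow> real" where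
  "cf_err a \<gamma> n = (-1) ^ n * (\<gamma> * real (cfq a n) - real (cfp a n))"

context
  fixes a :: "nat \<Rightarrow> nat"
  assumes a_pos: "\<And>i. i \<ge> 1 \<Longrightarrow> a i \<ge> 1"
begin

lemma cfq_1: "cfq a (Suc 0) = a 1"
  using a_pos[of 1] by (simp add: cfq_def length_word_power)

lemma cfq_pos: "cfq a n \<ge> 1"
  and cfq_Suc_ge: "cfq a n \<le> cfq a (Suc n)"
proof (induction n rule: induct_nat_012)
  case 0
  { case 1 show ?case by (simp add: cfq_0) }
  { case 2 show ?case using a_pos[of 1] by (simp add: cfq_0 cfq_1) }
next
  case 1
  { case 1 show ?case using a_pos[of 1] by (simp add: cfq_1) }
  { case 2 show ?case 
      using cfq_rec[of a 0] a_pos[of 2] by (cases "a 2") (simp_all add: numeral_2_eq_2) }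
next
  case (ge2 n)
  { case 1 show ?case using cfq_rec[of a n] ge2 by simp }
  { case 2 show ?case 
      using cfq_rec[of a "Suc n"] a_pos[of "Suc n + 2"]
      by (cases "a (Suc n + 2)") simp_all }
qed

lemma cf_frac_convergent: "cf_frac (map a [1..<Suc n]) = (cfp a n, cfq a n)"
proof (induction n rule: induct_nat_012)
  case 0 show ?case by (simp add: cfp_simps cfq_0)
next
  case 1 show ?case by (simp add: cfp_simps cfq_1)
next
  case (ge2 n)
  have "map a [1..<Suc (Suc (Suc n))] = map a [1..<Suc n] @ [a (Suc n), a (Suc (Suc n))]"
    "map a [1..<Suc (Suc n)] = map a [1..<Suc n] @ [a (Suc n)]"
    by simp_all
  with ge2 cf_frac_append[of "map a [1..<Suc n]" "a (Suc n)" "a (Suc (Suc n))"]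
  show ?case
    using cfp_simps(3)[of a n] cfq_rec[of a n] by (intro prod_eqI) simp_all
qed

lemma convergent_cf_eq: "convergent_cf a n = of_nat (cfp a n) / of_nat (cfq a n)"
  and cf_q_eq: "cf_q a n = int (cfq a n)"
proof -
  have "\<forall>x\<in>set (map a [1..<Suc n]). x \<ge> 1"
    using a_pos by auto
  from cfrac_eq_cf_frac[OF this] have *: "coprime (cfp a n) (cfq a n)"
    "cfrac (map a [1..<Suc n]) = of_nat (cfp a n) / of_nat (cfq a n)"
    unfolding cf_frac_convergent by simp_all
  then show 1: "convergent_cf a n = of_nat (cfp a n) / of_nat (cfq a n)"
    by (simp add: convergent_cf_def)
  also have "\<dots> = Fract (int (cfp a n)) (int (cfq a n))"
    by (simp add: Fract_of_int_quotient)
  finally show "cf_q a n = int (cfq a n)"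
    using *(1) cfq_pos[of n] unfolding cf_q_def by (simp add: quotient_of_Fract normalize_stable)
qed

lemma cf_det: "real (cfp a (Suc n)) * real (cfq a n) - real (cfq a (Suc n)) * real (cfp a n) = (-1) ^ n"
proof (induction n)
  case 0 show ?case by (simp add: cfp_simps cfq_0)
next
  case (Suc n)
  then show ?case
    using cfp_simps(3)[of a n] cfq_rec[of a n] by (simp add: algebra_simps)
qed

lemma cf_err_rec: "cf_err a \<gamma> n = real (a (n + 2)) * cf_err a \<gamma> (n + 1) + cf_err a \<gamma> (n + 2)"
  unfolding cf_err_def cfp_simps(3) cfq_rec by (simp add: algebra_simps)

text \<open>The vector (1, gamma) of length and frequency of ones is written in the basis of two
  consecutive vectors (q, p). The errors are thus the asymptotic proportions of two consecutive
  standard words.\<close>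

lemma cf_err_identities:
  "cf_err a \<gamma> n * real (cfq a (Suc n)) + cf_err a \<gamma> (Suc n) * real (cfq a n) = 1"
  "cf_err a \<gamma> n * real (cfp a (Suc n)) + cf_err a \<gamma> (Suc n) * real (cfp a n) = \<gamma>"
proof -
  define s :: real where "s = (-1) ^ n"
  have sq: "s * s = 1"
    unfolding s_def by (simp flip: power_add)
  have det: "real (cfp a (Suc n)) * real (cfq a n) - real (cfq a (Suc n)) * real (cfp a n) = s"
    using cf_det[of n] by (simp add: s_def)
  have err: "cf_err a \<gamma> n = s * (\<gamma> * real (cfq a n) - real (cfp a n))"
    "cf_err a \<gamma> (Suc n) = - s * (\<gamma> * real (cfq a (Suc n)) - real (cfp a (Suc n)))"
    by (simp_all add: cf_err_def s_def)
  have "cf_err a \<gamma> n * real (cfq a (Suc n)) + cf_err a \<gamma> (Suc n) * real (cfq a n)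
      = s * (real (cfp a (Suc n)) * real (cfq a n) - real (cfq a (Suc n)) * real (cfp a n))"
    unfolding err by (simp add: algebra_simps)
  then show "cf_err a \<gamma> n * real (cfq a (Suc n)) + cf_err a \<gamma> (Suc n) * real (cfq a n) = 1"
    by (simp only: det sq)
  show "cf_err a \<gamma> n * real (cfp a (Suc n)) + cf_err a \<gamma> (Suc n) * real (cfp a n) = \<gamma>"
  proof -
    have "cf_err a \<gamma> n * real (cfp a (Suc n)) + cf_err a \<gamma> (Suc n) * real (cfp a n)
      = \<gamma> * (s * (real (cfp a (Suc n)) * real (cfq a n) - real (cfq a (Suc n)) * real (cfp a n)))"
      unfolding err by (simp add: algebra_simps)
    then show ?thesis by (simp only: det sq mult_1_right)
  qed
qed

context
  fixes \<gamma> :: real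
  assumes irr: "\<gamma> \<notin> \<rat>" and cf: "has_cf_expansion \<gamma> a"
begin

text \<open>As a sequence in n, \<open>d\<close> obeys the recursion of the convergents from the
  values 0 and 1 at N and N + 1, so it is nonnegative. Divided by q_n it tends to the error, and
  irrationality excludes the value 0.\<close>

lemma cf_err_pos: "cf_err a \<gamma> N > 0"
proof -
  define d where "d = (\<lambda>n. (-1) ^ N * (real (cfp a n) * real (cfq a N) - real (cfq a n) * real (cfp a N)))"
  have "d (N + i) \<ge> 0" for i
  proof (induction i rule: induct_nat_012)
    case 0 show ?case by (simp add: d_def)
  next
    case 1 show ?case using cf_det[of N] by (simp add: d_def flip: power_add)
  next
    case (ge2 i)
    have "d (N + i + 2) = real (a (N + i + 2)) * d (N + i + 1) + d (N + i)"
      unfolding d_def cfp_simps(3) cfq_rec by (simp add: algebra_simps)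
    with ge2 show ?case by simp
  qed
  then have nonneg: "d n / real (cfq a n) \<ge> 0" if "n \<ge> N" for n
    using that by (metis le_Suc_ex divide_nonneg_nonneg of_nat_0_le_iff)
  have eq: "d n / real (cfq a n) =
      (-1) ^ N * (real_of_rat (convergent_cf a n) * real (cfq a N) - real (cfp a N))" for n
    using cfq_pos[of n]
    by (simp add: d_def convergent_cf_eq of_rat_divide field_simps)
  have "(\<lambda>n. real_of_rat (convergent_cf a n)) \<longlonglongrightarrow> \<gamma>"
    using cf by (simp add: has_cf_expansion_def)
  then have "(\<lambda>n. d n / real (cfq a n)) \<longlonglongrightarrow> cf_err a \<gamma> N"
    unfolding eq cf_err_def by (intro tendsto_intros)
  then have "cf_err a \<gamma> N \<ge> 0"
    using nonneg by (intro LIMSEQ_le_const) auto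
  moreover have "cf_err a \<gamma> N \<noteq> 0"
  proof
    assume "cf_err a \<gamma> N = 0"
    then have "\<gamma> = real (cfp a N) / real (cfq a N)"
      using cfq_pos[of N] by (simp add: cf_err_def field_simps)
    then have "\<gamma> \<in> \<rat>" by simp
    with irr show False ..
  qed
  ultimately show ?thesis by simp
qed

lemma cf_err_Suc_less: "cf_err a \<gamma> (Suc n) < cf_err a \<gamma> n"
proof -
  have "1 * cf_err a \<gamma> (Suc n) \<le> real (a (n + 2)) * cf_err a \<gamma> (Suc n)"
    using cf_err_pos[of "Suc n"] a_pos[of "n + 2"] by (intro mult_right_mono) auto
  with cf_err_rec[of \<gamma> n] cf_err_pos[of "n + 2"] show ?thesis by simp
qed

text \<open>For a 1 = 1 the second convergent a_2 / (a_2 + 1) is at least 1/2, yet it lies below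
  gamma.\<close>

lemma first_quotient_ge_2:
  assumes "\<gamma> < 1 / 2"
  shows "a 1 \<ge> 2"
proof (rule ccontr)
  assume "\<not> a 1 \<ge> 2"
  then have a1: "a 1 = 1" using a_pos[of 1] by simp
  have "cf_err a \<gamma> 2 > 0" by (rule cf_err_pos)
  then have "real (a 2) < \<gamma> * (real (a 2) + 1)"
    using cfq_rec[of a 0] cfp_simps(3)[of a 0] a1
    by (simp add: cf_err_def cfp_simps cfq_0 cfq_1 numeral_2_eq_2 add.commute)
  also have "\<dots> \<le> 1 / 2 * (real (a 2) + 1)"
    using assms by (intro mult_right_mono) auto
  finally show False using a_pos[of 2] by simp
qed

end

end

section \<open>Joint spectral radius and extremal sequences\<close>

lemma fekete:
  fixes f :: "nat \<Rightarrow> real"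
  assumes sub: "\<And>m n. f (m + n) \<le> f m + f n" and nonneg: "\<And>n. f n \<ge> 0"
  obtains c where "(\<lambda>n. f n / real n) \<longlonglongrightarrow> c" "\<And>n. real n * c \<le> f n" "c \<ge> 0"
proof
  define c where "c = (INF n\<in>{1..}. f n / real n)"
  have bdd: "bdd_below ((\<lambda>n. f n / real n) ` {1..})"
    using nonneg by (intro bdd_belowI[of _ 0]) auto
  show lower: "real n * c \<le> f n" for n
  proof (cases "n = 0")
    case False
    then have "c \<le> f n / real n"
      unfolding c_def by (intro cINF_lower[OF bdd]) simp
    with False show ?thesis by (simp add: field_simps)
  qed (simp add: nonneg)
  show "c \<ge> 0"
    unfolding c_def using nonneg by (intro cINF_greatest) auto
  have mult: "f (k * m) \<le> real k * f m" if "k \<ge> 1" for k m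
    using that
  proof (induction k rule: dec_induct)
    case (step k)
    have "f (Suc k * m) \<le> f m + f (k * m)" using sub[of m "k * m"] by simp
    with step show ?case by (simp add: algebra_simps)
  qed simp
  show "(\<lambda>n. f n / real n) \<longlonglongrightarrow> c"
  proof (rule LIMSEQ_I)
    fix e :: real assume e: "e > 0"
    have "\<exists>m\<in>{1..}. f m / real m < c + e / 2"
      using cINF_less_iff[OF _ bdd, of "c + e / 2"] e by (simp add: c_def)
    then obtain m where m: "m \<ge> 1" "f m / real m < c + e / 2" by auto
    define K where "K = Max (f ` {..<m})"
    have K: "f i \<le> K" if "i < m" for i
      unfolding K_def using that by (intro Max_ge) auto
    have K0: "K \<ge> 0" using K[of 0] nonneg[of 0] m by auto
    obtain N where N: "2 * K / e < real N" using reals_Archimedean2 by blast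
    show "\<exists>no. \<forall>n\<ge>no. norm (f n / real n - c) < e"
    proof (intro exI allI impI)
      fix n assume n: "n \<ge> N + m"
      then have n0: "n > 0" and nm: "n div m \<ge> 1" using m by (auto simp: div_greater_zero_iff Suc_le_eq)
      have "f n \<le> f (n div m * m) + f (n mod m)"
        using sub[of "n div m * m" "n mod m"] by simp
      also have "\<dots> \<le> real (n div m) * f m + K"
        using mult[OF nm] K[of "n mod m"] m by (intro add_mono) auto
      also have "\<dots> \<le> real (n div m) * (real m * (c + e / 2)) + K"
        using m by (intro add_right_mono mult_left_mono) (auto simp: field_simps)
      also have "\<dots> = real (n div m * m) * (c + e / 2) + K" by simp
      also have "\<dots> \<le> real n * (c + e / 2) + K"
      proof (intro add_right_mono mult_right_mono)
        show "real (n div m * m) \<le> real n"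
          by (simp only: of_nat_le_iff div_times_less_eq_dividend)
      qed (use \<open>c \<ge> 0\<close> e in auto)
      also have "K < real n * (e / 2)"
      proof -
        have "K < real N * (e / 2)" using N e by (simp add: field_simps)
        also have "\<dots> \<le> real n * (e / 2)" using n e by (intro mult_right_mono) auto
        finally show ?thesis .
      qed
      finally have "f n < real n * (c + e)" by (simp add: algebra_simps)
      then have "f n / real n < c + e" using n0 by (simp add: field_simps)
      moreover have "c \<le> f n / real n" using lower[of n] n0 by (simp add: field_simps)
      ultimately show "norm (f n / real n - c) < e" by simp
    qed
  qed
qed

lemma diagonal_word_prod_A_mat_ge_1:
  "word_prod A_mat u $1$1 \<ge> 1" "word_prod A_mat u $2$2 \<ge> 1"
proof (induction u)
  case (Cons x u)
  have nn: "word_prod A_mat u $1$2 \<ge> 0" "word_prod A_mat u $2$1 \<ge> 0"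
    using nonneg_word_prod_A_mat[of u] by (auto simp: nonneg_mat2)
  { case 1 show ?case using Cons nn by (cases x) (auto simp: mat2_simps) }
  { case 2 show ?case using Cons nn by (cases x) (auto simp: mat2_simps) }
qed (simp_all add: mat_def)

lemma entry_sum_word_prod_ge_1: "entry_sum (word_prod A_mat u) \<ge> 1"
  using diagonal_word_prod_A_mat_ge_1[of u] nonneg_word_prod_A_mat[of u]
  by (simp add: entry_sum_def nonneg_mat2)

lemma onorm_entry_sum:
  fixes M :: "real^2^2"
  assumes "nonneg_mat M"
  shows "onorm ((*v) M) \<le> entry_sum M" "entry_sum M \<le> 4 * onorm ((*v) M)"
proof -
  show "onorm ((*v) M) \<le> entry_sum M"
    using onorm_le_matrix_component_sum[of M] assms
    by (simp add: sum_2 nonneg_mat2 entry_sum_def)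
  show "entry_sum M \<le> 4 * onorm ((*v) M)"
    using matrix_component_le_onorm[of M 1 1] matrix_component_le_onorm[of M 1 2]
      matrix_component_le_onorm[of M 2 1] matrix_component_le_onorm[of M 2 2]
    unfolding entry_sum_def by linarith
qed

section \<open>The joint spectral radius through maximal log weights\<close>

lemma Max_growth_props:
  fixes B :: "letter \<Rightarrow> real^'n^'n"
  shows "finite {growth B u | u. length u = n}" "{growth B u | u. length u = n} \<noteq> {}"
proof -
  show "finite {growth B u | u. length u = n}"
    using finite_imageI[OF finite_words[of n], of "growth B"] by (simp add: setcompr_eq_image)
  show "{growth B u | u. length u = n} \<noteq> {}"
    using length_replicate[of n Zero] by blast
qed

text \<open>Logarithm of the entry sum of the weighted product at alpha = exp t.\<close>

definition log_weight :: "real \<Rightarrow> letter list \<Rightarrow> real" where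
  "log_weight t u = ln (entry_sum (word_prod A_mat u)) + real (count_list u One) * t"

definition max_log_weight :: "real \<Rightarrow> nat \<Rightarrow> real" where
  "max_log_weight t n = Max (log_weight t ` {u. length u = n})"

lemma log_weight_le_max: "log_weight t u \<le> max_log_weight t (length u)"
  unfolding max_log_weight_def using finite_words by (intro Max_ge) auto

lemma max_log_weight_attained:
  obtains u where "length u = n" "log_weight t u = max_log_weight t n"
proof -
  have "max_log_weight t n \<in> log_weight t ` {u. length u = n}"
    unfolding max_log_weight_def using length_replicate[of n Zero]
    by (intro Max_in finite_imageI finite_words) blast
  then show ?thesis using that by auto
qed

lemma log_weight_append_le: "log_weight t (u @ v) \<le> log_weight t u + log_weight t v"
proof -
  have "entry_sum (word_prod A_mat (u @ v))
      \<le> entry_sum (word_prod A_mat v) * entry_sum (word_prod A_mat u)"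
    unfolding word_prod_append by (intro entry_sum_mult_le nonneg_word_prod_A_mat)
  then have "ln (entry_sum (word_prod A_mat (u @ v)))
      \<le> ln (entry_sum (word_prod A_mat v) * entry_sum (word_prod A_mat u))"
    using entry_sum_word_prod_ge_1[of "u @ v"] by (intro ln_mono) auto
  also have "\<dots> = ln (entry_sum (word_prod A_mat v)) + ln (entry_sum (word_prod A_mat u))"
    using entry_sum_word_prod_ge_1[of u] entry_sum_word_prod_ge_1[of v] by (simp add: ln_mult)
  finally show ?thesis by (simp add: log_weight_def algebra_simps)
qed

lemma max_log_weight_subadditive: "max_log_weight t (m + n) \<le> max_log_weight t m + max_log_weight t n"
proof -
  obtain u where u: "length u = m + n" "log_weight t u = max_log_weight t (m + n)"
    by (rule max_log_weight_attained)
  have "log_weight t (take m u @ drop m u) \<le> log_weight t (take m u) + log_weight t (drop m u)"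
    by (rule log_weight_append_le)
  also have "\<dots> \<le> max_log_weight t m + max_log_weight t n"
    using log_weight_le_max[of t "take m u"] log_weight_le_max[of t "drop m u"] u(1)
    by (intro add_mono) auto
  finally show ?thesis using u(2) by simp
qed

lemma max_log_weight_nonneg: "max_log_weight t n \<ge> 0"
proof -
  have "0 \<le> log_weight t (replicate n Zero)"
    using entry_sum_word_prod_ge_1 by (auto simp: log_weight_def count_list_0_iff)
  also have "\<dots> \<le> max_log_weight t n"
    using log_weight_le_max[of t "replicate n Zero"] by simp
  finally show ?thesis .
qed

text \<open>Entry sum and operator norm differ by a factor of at most 4, which becomes negligible
  under the root.\<close>

lemma growth_bounds:
  assumes "\<alpha> > 0" "u \<noteq> []"
  shows "growth (A_weighted \<alpha>) u \<le> exp (log_weight (ln \<alpha>) u / real (length u))"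
    and "exp ((log_weight (ln \<alpha>) u - ln 4) / real (length u)) \<le> growth (A_weighted \<alpha>) u"
proof -
  define M where "M = word_prod (A_weighted \<alpha>) u"
  have M: "M = \<alpha> ^ count_list u One *\<^sub>R word_prod A_mat u"
    unfolding M_def by (rule word_prod_scaleR)
  have "nonneg_mat M"
    using nonneg_word_prod_A_mat[of u] assms(1) by (simp add: M nonneg_mat2)
  moreover have es: "entry_sum M = exp (log_weight (ln \<alpha>) u)"
  proof -
    have "entry_sum M = entry_sum (word_prod A_mat u) * \<alpha> ^ count_list u One"
      by (simp add: M entry_sum_def algebra_simps)
    then show ?thesis
      using entry_sum_word_prod_ge_1[of u] assms(1)
      by (simp add: log_weight_def exp_add exp_of_nat_mult)
  qed
  ultimately have *: "onorm ((*v) M) \<le> exp (log_weight (ln \<alpha>) u)"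
    "exp (log_weight (ln \<alpha>) u - ln 4) \<le> onorm ((*v) M)"
    using onorm_entry_sum[of M] by (simp_all add: exp_diff)
  have root: "root (length u) (exp y) = exp (y / real (length u))" for y
    using assms(2) by (intro real_root_pos_unique) (auto simp flip: exp_of_nat_mult)
  show "growth (A_weighted \<alpha>) u \<le> exp (log_weight (ln \<alpha>) u / real (length u))"
    using * assms(2) unfolding growth_def M_def[symmetric] root[symmetric] by simp
  show "exp ((log_weight (ln \<alpha>) u - ln 4) / real (length u)) \<le> growth (A_weighted \<alpha>) u"
    using * assms(2) unfolding growth_def M_def[symmetric] root[symmetric] by simp
qed

lemma tendsto_const_over_n: "(\<lambda>n. c / real n) \<longlonglongrightarrow> 0"
  using tendsto_mult[OF tendsto_const[of c] lim_inverse_n] by (simp add: divide_inverse)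

lemma joint_spectral_radius_eq:
  assumes \<alpha>: "\<alpha> > 0" and lim: "(\<lambda>n. max_log_weight (ln \<alpha>) n / real n) \<longlonglongrightarrow> c"
  shows "joint_spectral_radius (A_weighted \<alpha>) = exp c"
proof -
  define g where "g = (\<lambda>n. Max {growth (A_weighted \<alpha>) u | u. length u = n})"
  have "g n \<le> exp (max_log_weight (ln \<alpha>) n / real n)" if "n \<ge> 1" for n
  proof -
    have "growth (A_weighted \<alpha>) u \<le> exp (max_log_weight (ln \<alpha>) n / real n)" if "length u = n" for u
    proof -
      have "u \<noteq> []" using that \<open>n \<ge> 1\<close> by auto
      have "growth (A_weighted \<alpha>) u \<le> exp (log_weight (ln \<alpha>) u / real n)"
        using growth_bounds(1)[OF \<alpha> \<open>u \<noteq> []\<close>] that by simp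
      also have "\<dots> \<le> exp (max_log_weight (ln \<alpha>) n / real n)"
        using log_weight_le_max[of "ln \<alpha>" u] that by (simp add: divide_right_mono)
      finally show ?thesis .
    qed
    then show ?thesis
      unfolding g_def using Max_growth_props[of "A_weighted \<alpha>" n] by (intro Max.boundedI) auto
  qed
  moreover have "exp ((max_log_weight (ln \<alpha>) n - ln 4) / real n) \<le> g n" if "n \<ge> 1" for n
  proof -
    obtain u where u: "length u = n" "log_weight (ln \<alpha>) u = max_log_weight (ln \<alpha>) n"
      by (rule max_log_weight_attained)
    have "exp ((max_log_weight (ln \<alpha>) n - ln 4) / real n) \<le> growth (A_weighted \<alpha>) u"
      using growth_bounds(2)[OF \<alpha>, of u] u that by (cases u) auto
    also have "\<dots> \<le> g n"
      unfolding g_def using Max_growth_props[of "A_weighted \<alpha>" n] u(1) by (intro Max_ge) auto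
    finally show ?thesis .
  qed
  moreover have upper: "(\<lambda>n. exp (max_log_weight (ln \<alpha>) n / real n)) \<longlonglongrightarrow> exp c"
    using lim by (intro tendsto_exp)
  moreover have lower: "(\<lambda>n. exp ((max_log_weight (ln \<alpha>) n - ln 4) / real n)) \<longlonglongrightarrow> exp c"
    using tendsto_exp[OF tendsto_diff[OF lim tendsto_const_over_n[of "ln 4"]]]
    by (simp add: diff_divide_distrib)
  ultimately have "g \<longlonglongrightarrow> exp c"
    by (intro tendsto_sandwich[rotated 2, OF lower upper])
      (auto intro: eventually_sequentiallyI[of 1])
  then show ?thesis
    unfolding joint_spectral_radius_def g_def by (rule limI)
qed

lemma growth_tendsto_iff:
  assumes \<alpha>: "\<alpha> > 0"
  shows "(\<lambda>n. growth (A_weighted \<alpha>) (map x [0..<n])) \<longlonglongrightarrow> exp c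
    \<longleftrightarrow> (\<lambda>n. log_weight (ln \<alpha>) (map x [0..<n]) / real n) \<longlonglongrightarrow> c"
    (is "?g \<longlonglongrightarrow> _ \<longleftrightarrow> ?w \<longlonglongrightarrow> _")
proof -
  have bounds: "exp (?w n - ln 4 / real n) \<le> ?g n" "?g n \<le> exp (?w n)" if "n \<ge> 1" for n
    using growth_bounds[OF \<alpha>, of "map x [0..<n]"] that by (auto simp: diff_divide_distrib)
  show ?thesis
  proof
    assume g: "?g \<longlonglongrightarrow> exp c"
    have pos: "?g n > 0" if "n \<ge> 1" for n
      using bounds(1)[OF that] by (rule less_le_trans[OF exp_gt_zero])
    have l: "(\<lambda>n. ln (?g n)) \<longlonglongrightarrow> c"
      using tendsto_ln[OF g] by simp
    have "\<forall>\<^sub>F n in sequentially. ln (?g n) \<le> ?w n"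
      using bounds(2) pos by (intro eventually_sequentiallyI[of 1]) (metis ln_exp ln_mono)
    moreover have "\<forall>\<^sub>F n in sequentially. ?w n \<le> ln (?g n) + ln 4 / real n"
    proof (rule eventually_sequentiallyI[of 1])
      fix n :: nat assume n: "1 \<le> n"
      have "ln (exp (?w n - ln 4 / real n)) \<le> ln (?g n)"
        using bounds(1)[OF n] by (intro ln_mono) auto
      then show "?w n \<le> ln (?g n) + ln 4 / real n" by simp
    qed
    moreover have "(\<lambda>n. ln (?g n) + ln 4 / real n) \<longlonglongrightarrow> c"
      using tendsto_add[OF l tendsto_const_over_n[of "ln 4"]] by simp
    ultimately show "?w \<longlonglongrightarrow> c"
      using l by (intro tendsto_sandwich[of "\<lambda>n. ln (?g n)" ?w])
  next
    assume w: "?w \<longlonglongrightarrow> c"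
    have lower: "(\<lambda>n. exp (?w n - ln 4 / real n)) \<longlonglongrightarrow> exp c"
      using tendsto_exp[OF tendsto_diff[OF w tendsto_const_over_n[of "ln 4"]]] by simp
    show "?g \<longlonglongrightarrow> exp c"
      using bounds by (intro tendsto_sandwich[rotated 2, OF lower tendsto_exp[OF w]])
        (auto intro: eventually_sequentiallyI[of 1])
  qed
qed

text \<open>The easy half of the Berger-Wang formula: the powers of \<open>u\<close> compete in the
  maxima defining \<open>c\<close>, and their entry sums are at least the powers of the spectral
  radius of \<open>u\<close>.\<close>

lemma log_spectral_radius_le:
  assumes lim: "(\<lambda>n. max_log_weight t n / real n) \<longlonglongrightarrow> c"
    and "u \<noteq> []" "trace (word_prod A_mat u) \<ge> 2"
  shows "ln (spectral_radius (word_prod A_mat u)) + real (count_list u One) * t \<le> real (length u) * c"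
proof -
  define s where "s = spectral_radius (word_prod A_mat u)"
  have s: "s \<ge> 1"
    unfolding s_def using spectral_radius_sum_inverse(1)[OF det_word_prod_A_mat assms(3)] .
  have "real k * (ln s + real (count_list u One) * t) \<le> max_log_weight t (k * length u)" for k
  proof -
    have "s ^ k \<le> trace (word_prod A_mat (word_power u k))"
      unfolding s_def by (rule trace_word_prod_power[OF det_word_prod_A_mat assms(3)])
    also have "\<dots> \<le> entry_sum (word_prod A_mat (word_power u k))"
      by (rule trace_le_entry_sum[OF nonneg_word_prod_A_mat])
    finally have "ln (s ^ k) \<le> ln (entry_sum (word_prod A_mat (word_power u k)))"
      using s by (intro ln_mono) auto
    then have "real k * (ln s + real (count_list u One) * t) \<le> log_weight t (word_power u k)"
      using s by (simp add: log_weight_def count_list_word_power ln_realpow algebra_simps)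
    also have "\<dots> \<le> max_log_weight t (k * length u)"
      using log_weight_le_max[of t "word_power u k"] by (simp add: length_word_power)
    finally show ?thesis .
  qed
  note le = this
  have "(ln s + real (count_list u One) * t) / real (length u)
      \<le> max_log_weight t (k * length u) / real (k * length u)" if "k \<ge> 1" for k
  proof -
    have "(ln s + real (count_list u One) * t) / real (length u)
        = (real k * (ln s + real (count_list u One) * t)) / real (k * length u)"
      using that by simp
    also have "\<dots> \<le> max_log_weight t (k * length u) / real (k * length u)"
      using le[of k] by (rule divide_right_mono) simp
    finally show ?thesis .
  qed
  moreover have "filterlim (\<lambda>k. k * length u) at_top sequentially"
    using assms(2) by (intro filterlim_subseq strict_monoI) simp
  from filterlim_compose[OF lim this]
  have "(\<lambda>k. max_log_weight t (k * length u) / real (k * length u)) \<longlonglongrightarrow> c" .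
  ultimately have "(ln s + real (count_list u One) * t) / real (length u) \<le> c"
    by (intro LIMSEQ_le_const) auto
  then show ?thesis
    using assms(2) by (simp add: s_def field_simps)
qed

section \<open>Construction of an extremal sequence\<close>

definition corner_weight :: "real \<Rightarrow> letter list \<Rightarrow> real" where
  "corner_weight t u = ln (word_prod A_mat u $2$2) + real (count_list u One) * t"

lemma corner_weight_append_ge: "corner_weight t (u @ v) \<ge> corner_weight t u + corner_weight t v"
proof -
  define M N where "M = word_prod A_mat u" and "N = word_prod A_mat v"
  have pos: "M$2$2 \<ge> 1" "N$2$2 \<ge> 1"
    unfolding M_def N_def by (rule diagonal_word_prod_A_mat_ge_1)+
  have nn: "nonneg_mat M" "nonneg_mat N"
    unfolding M_def N_def by (rule nonneg_word_prod_A_mat)+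
  have "ln (N$2$2) + ln (M$2$2) = ln (N$2$2 * M$2$2)"
    using pos by (simp add: ln_mult)
  also have "\<dots> \<le> ln ((N ** M)$2$2)"
    using pos nn by (intro ln_mono) (auto simp: mat2_simps nonneg_mat2)
  finally show ?thesis
    by (simp add: corner_weight_def word_prod_append M_def N_def algebra_simps)
qed

lemma corner_weight_ge: "corner_weight t u \<ge> - real (length u) * \<bar>t\<bar>"
proof -
  have "ln (word_prod A_mat u $2$2) \<ge> 0"
    using diagonal_word_prod_A_mat_ge_1[of u] by simp
  moreover have "\<bar>real (count_list u One) * t\<bar> \<le> real (length u) * \<bar>t\<bar>"
    unfolding abs_mult using length_count_list[of u] by (intro mult_right_mono) auto
  ultimately show ?thesis
    unfolding corner_weight_def by linarith
qed

lemma corner_weight_le: "corner_weight t u \<le> log_weight t u"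
proof -
  have "ln (word_prod A_mat u $2$2) \<le> ln (entry_sum (word_prod A_mat u))"
    using diagonal_word_prod_A_mat_ge_1[of u] nonneg_word_prod_A_mat[of u]
    by (intro ln_mono) (auto simp: entry_sum_def nonneg_mat2)
  then show ?thesis by (simp add: corner_weight_def log_weight_def)
qed

lemma corner_weight_zero_one: "corner_weight t (Zero # u @ [One]) = log_weight t u + t"
  unfolding corner_weight_def component22_zero_one
  by (simp add: log_weight_def algebra_simps)

text \<open>Optimal words \<open>w j\<close> of every length \<open>j\<close> are glued in the form \<open>Zero # w j @ [One]\<close>:
  the lower right entry is supermultiplicative, and at \<open>Zero # u @ [One]\<close> it is the entry sum at \<open>u\<close>.\<close>

lemma extremal_sequence_exists:
  assumes lim: "(\<lambda>n. max_log_weight t n / real n) \<longlonglongrightarrow> c"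
    and lower: "\<And>n. real n * c \<le> max_log_weight t n" and c0: "c \<ge> 0"
  shows "\<exists>x. (\<lambda>n. log_weight t (map x [0..<n]) / real n) \<longlonglongrightarrow> c"
proof -
  have "\<forall>j. \<exists>u. length u = j \<and> log_weight t u = max_log_weight t j"
    using max_log_weight_attained by metis
  then obtain w where w: "\<And>j. length (w j) = j" "\<And>j. log_weight t (w j) = max_log_weight t j"
    by metis
  define block where "block = (\<lambda>j. Zero # w j @ [One])"
  define pre where "pre = (\<lambda>J. concat (map block [0..<J]))"
  have pre_Suc: "pre (Suc J) = pre J @ block J" for J
    by (simp add: pre_def)
  have block: "length (block j) = j + 2" "corner_weight t (block j) \<ge> real j * c + t" for j
    using lower[of j] w by (simp_all add: block_def corner_weight_zero_one)
  \<comment> \<open>Block lengths grow linearly, so the first n letters meet only about sqrt n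
    blocks. The bounded loss per block and the incomplete last block then cost O(sqrt n).\<close>
  have len: "2 * length (pre J) = J * (J + 3)" for J
  proof (induction J)
    case 0 show ?case by (simp add: pre_def)
  next
    case (Suc J) then show ?case by (simp add: pre_Suc block algebra_simps)
  qed
  have weight: "corner_weight t (pre J) \<ge> (real (length (pre J)) - 2 * real J) * c + real J * t" for J
  proof (induction J)
    case 0 show ?case by (simp add: pre_def corner_weight_def mat_def)
  next
    case (Suc J)
    have "(real (length (pre (Suc J))) - 2 * real (Suc J)) * c + real (Suc J) * t
        = ((real (length (pre J)) - 2 * real J) * c + real J * t) + (real J * c + t)"
      by (simp add: pre_Suc block algebra_simps)
    also have "\<dots> \<le> corner_weight t (pre J) + corner_weight t (block J)"
      using Suc block(2)[of J] by (intro add_mono) auto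
    also have "\<dots> \<le> corner_weight t (pre (Suc J))"
      unfolding pre_Suc by (rule corner_weight_append_ge)
    finally show ?case .
  qed
  have pre_mono: "\<exists>y. pre K = pre J @ y" if "J \<le> K" for J K
    using that
  proof (induction K rule: dec_induct)
    case (step K) then show ?case by (auto simp: pre_Suc)
  qed simp
  have len_ge: "n < length (pre (Suc n))" for n
  proof -
    have "Suc n * 2 \<le> 2 * length (pre (Suc n))"
      unfolding len by (intro mult_le_mono2) simp
    then show ?thesis by simp
  qed
  define x where "x = (\<lambda>i. pre (Suc i) ! i)"
  have x_pre: "map x [0..<n] = take n (pre K)" if n: "n \<le> length (pre K)" for n K
  proof (rule nth_equalityI)
    show "length (map x [0..<n]) = length (take n (pre K))" using n by simp
    fix i assume "i < length (map x [0..<n])"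
    then have i: "i < n" by simp
    obtain y z where "pre (max (Suc i) K) = pre (Suc i) @ y" "pre (max (Suc i) K) = pre K @ z"
      using pre_mono[of "Suc i" "max (Suc i) K"] pre_mono[of K "max (Suc i) K"] by auto
    then have "pre (Suc i) ! i = pre K ! i"
      using len_ge[of i] i n by (metis nth_append order_less_le_trans)
    then show "map x [0..<n] ! i = take n (pre K) ! i"
      using i by (simp add: x_def)
  qed
  define K where "K = c + \<bar>t\<bar>"
  have K0: "K \<ge> 0" using c0 by (simp add: K_def)
  have lower_bound: "log_weight t (map x [0..<n]) \<ge> real n * c - 8 * sqrt (real n) * K" if n: "n \<ge> 1" for n
  proof -
    have "\<exists>J. length (pre J) \<le> n \<and> n < length (pre (Suc J))"
    proof -
      define J where "J = (LEAST J. n < length (pre (Suc J)))"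
      have 1: "n < length (pre (Suc J))"
        unfolding J_def by (rule LeastI[of _ n]) (rule len_ge)
      have "length (pre J) \<le> n"
      proof (cases J)
        case 0 then show ?thesis by (simp add: pre_def)
      next
        case (Suc J')
        then show ?thesis
          using not_less_Least[of J' "\<lambda>J. n < length (pre (Suc J))"] by (simp add: J_def)
      qed
      with 1 show ?thesis by blast
    qed
    then obtain J where J: "length (pre J) \<le> n" "n < length (pre (Suc J))" by blast
    \<comment> \<open>The incomplete last block has length at most J + 2; the crude bound
      \<open>corner_weight_ge\<close> suffices for it.\<close>
    define y where "y = take (n - length (pre J)) (block J)"
    have pref: "map x [0..<n] = pre J @ y"
      using x_pre[of n "Suc J"] J by (simp add: pre_Suc y_def)
    have ly: "real (length y) \<le> real J + 2"
      using block(1)[of J] by (simp add: y_def)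
    have n_le: "real n \<le> real (length (pre J)) + real J + 2"
      using J(2) by (simp add: pre_Suc block)
    have "J * J \<le> 2 * length (pre J)"
      unfolding len by simp
    then have "J * J \<le> 2 * n"
      using J(1) by simp
    then have "real J * real J \<le> 2 * real n" by (metis of_nat_le_iff of_nat_mult of_nat_numeral)
    also have "\<dots> \<le> (2 * sqrt (real n)) * (2 * sqrt (real n))" by simp
    finally have J_le: "real J \<le> 2 * sqrt (real n)"
      using power2_le_imp_le[of "real J" "2 * sqrt (real n)"] by (simp add: power2_eq_square)
    have "corner_weight t (pre J) + corner_weight t y \<le> log_weight t (map x [0..<n])"
      unfolding pref using corner_weight_append_ge corner_weight_le order_trans by blast
    moreover have "corner_weight t y \<ge> - ((real J + 2) * \<bar>t\<bar>)"
      using corner_weight_ge[of y t] mult_right_mono[OF ly, of "\<bar>t\<bar>"] by simp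
    moreover have "(real n - (3 * real J + 2)) * c \<le> (real (length (pre J)) - 2 * real J) * c"
      using n_le c0 by (intro mult_right_mono) auto
    moreover have "real J * t \<ge> - (real J * \<bar>t\<bar>)"
      using mult_left_mono[of "- \<bar>t\<bar>" t "real J"] by simp
    ultimately have "real n * c - (3 * real J + 2) * c - (2 * real J + 2) * \<bar>t\<bar>
        \<le> log_weight t (map x [0..<n])"
      using weight[of J] by (simp add: algebra_simps)
    moreover have "(2 * real J + 2) * \<bar>t\<bar> \<le> (3 * real J + 2) * \<bar>t\<bar>"
      by (intro mult_right_mono) auto
    ultimately have "real n * c - (3 * real J + 2) * K \<le> log_weight t (map x [0..<n])"
      unfolding K_def distrib_left by linarith
    moreover have "(3 * real J + 2) * K \<le> 8 * sqrt (real n) * K"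
    proof (rule mult_right_mono)
      \<comment> \<open>The constant 8 is 3 * 2 from J <= 2 sqrt n plus 2 from 1 <= sqrt n.\<close>
      have "1 \<le> sqrt (real n)" using n by simp
      then show "3 * real J + 2 \<le> 8 * sqrt (real n)"
        using J_le by linarith
    qed (rule K0)
    ultimately show ?thesis by linarith
  qed
  have "(\<lambda>n. c - 8 * K / sqrt (real n)) \<longlonglongrightarrow> c - 0"
    by (intro tendsto_diff tendsto_const tendsto_divide_0[OF tendsto_const]
        filterlim_at_top_imp_at_infinity filterlim_compose[OF sqrt_at_top filterlim_real_sequentially])
  then have low_lim: "(\<lambda>n. c - 8 * K / sqrt (real n)) \<longlonglongrightarrow> c" by simp
  have "(\<lambda>n. log_weight t (map x [0..<n]) / real n) \<longlonglongrightarrow> c"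
  proof (rule tendsto_sandwich[rotated 2, OF low_lim lim])
    show "\<forall>\<^sub>F n in sequentially. c - 8 * K / sqrt (real n) \<le> log_weight t (map x [0..<n]) / real n"
    proof (rule eventually_sequentiallyI[of 1])
      fix n :: nat assume n: "1 \<le> n"
      have "c - 8 * K / sqrt (real n) = (real n * c - 8 * sqrt (real n) * K) / real n"
        using n by (simp add: field_simps real_sqrt_mult_self flip: power2_eq_square)
      also have "\<dots> \<le> log_weight t (map x [0..<n]) / real n"
        by (rule divide_right_mono[OF lower_bound[OF n]]) simp
      finally show "c - 8 * K / sqrt (real n) \<le> log_weight t (map x [0..<n]) / real n" .
    qed
    show "\<forall>\<^sub>F n in sequentially. log_weight t (map x [0..<n]) / real n \<le> max_log_weight t n / real n"
    proof (intro always_eventually allI divide_right_mono)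
      show "log_weight t (map x [0..<n]) \<le> max_log_weight t n" for n
        using log_weight_le_max[of t "map x [0..<n]"] by simp
    qed simp
  qed
  then show ?thesis by blast
qed

text \<open>This serves to exclude alpha = 0: there any product containing \<open>One\<close>
  vanishes, so the constant word \<open>Zero\<close> is extremal and the ratio function takes the
  value 0.\<close>

lemma growth_A_weighted_0_tendsto:
  "(\<lambda>n. growth (A_weighted 0) (map (\<lambda>_. Zero) [0..<n])) \<longlonglongrightarrow> joint_spectral_radius (A_weighted 0)"
proof -
  define g where "g = (\<lambda>n. growth (A_weighted 0) (replicate n Zero))"
  define M where "M = (\<lambda>n. vector [vector [1, real n], vector [0, 1]] :: real^2^2)"
  have M: "word_prod (A_weighted 0) (replicate n Zero) = M n" for n
    by (induction n) (simp_all add: M_def mat2_simps)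
  have onorm: "1 \<le> onorm ((*v) (M n))" "onorm ((*v) (M n)) \<le> real n + 2" for n
    using matrix_component_le_onorm[of "M n" 1 1] onorm_entry_sum(1)[of "M n"]
    by (auto simp: M_def entry_sum_def nonneg_mat2)
  have g: "g n = root n (onorm ((*v) (M n)))" for n
    by (simp add: g_def growth_def M)
  have g_pos: "g n \<ge> 0" for n
    unfolding g using onorm(1)[of n] by (intro real_root_ge_zero) linarith
  have le: "growth (A_weighted 0) u \<le> g n" if u: "length u = n" for u n
  proof (cases "One \<in> set u")
    case True
    then have "count_list u One \<noteq> 0" by (simp add: count_list_0_iff)
    then have "word_prod (A_weighted 0) u = 0"
      unfolding word_prod_scaleR by (simp add: zero_power)
    moreover have "(*v) (0 :: real^2^2) = (\<lambda>x. 0)"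
      by (simp add: fun_eq_iff)
    ultimately have "growth (A_weighted 0) u = 0"
      by (simp add: growth_def onorm_zero)
    then show ?thesis using g_pos by simp
  next
    case False
    have "u = replicate n Zero"
      using False u by (metis letter.exhaust replicate_eqI)
    then show ?thesis by (simp add: g_def)
  qed
  have Max_eq: "Max {growth (A_weighted 0) u | u. length u = n} = g n" for n
  proof (rule Max_eqI)
    show "finite {growth (A_weighted 0) u | u. length u = n}"
      by (rule Max_growth_props)
    show "g n \<in> {growth (A_weighted 0) u | u. length u = n}"
      unfolding g_def using length_replicate[of n Zero] by blast
  qed (use le in auto)
  have "(\<lambda>n. root n 3 * root n (real n)) \<longlonglongrightarrow> 1 * 1"
    by (intro tendsto_mult LIMSEQ_root LIMSEQ_root_const) simp
  then have upper: "(\<lambda>n. root n 3 * root n (real n)) \<longlonglongrightarrow> 1" by simp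
  have "g \<longlonglongrightarrow> 1"
  proof (rule tendsto_sandwich[rotated 2, OF tendsto_const upper])
    show "\<forall>\<^sub>F n in sequentially. 1 \<le> g n"
      using onorm(1) by (intro eventually_sequentiallyI[of 1]) (simp add: g)
    show "\<forall>\<^sub>F n in sequentially. g n \<le> root n 3 * root n (real n)"
    proof (rule eventually_sequentiallyI[of 1])
      fix n :: nat assume n: "1 \<le> n"
      have "g n \<le> root n (3 * real n)"
        using onorm(2)[of n] n by (simp add: g)
      then show "g n \<le> root n 3 * root n (real n)" by (simp add: real_root_mult)
    qed
  qed
  then have "joint_spectral_radius (A_weighted 0) = 1"
    unfolding joint_spectral_radius_def Max_eq by (rule limI)
  with \<open>g \<longlonglongrightarrow> 1\<close> show ?thesis
    by (simp add: g_def map_replicate_const)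
qed

section \<open>Optimality gaps of the standard words\<close>

lemma rho_eq_srho:
  "rho a (int n) = srho a (Suc n)" "rho a (int n - 1) = srho a n" "rho a (int n + 1) = srho a (n + 2)"
proof -
  have "nat (int n + 1) = Suc n" "nat (int n - 1 + 1) = n" "nat (int n + 1 + 1) = n + 2"
    by simp_all
  then show "rho a (int n) = srho a (Suc n)" "rho a (int n - 1) = srho a n"
      "rho a (int n + 1) = srho a (n + 2)"
    unfolding rho_def std_word_def srho_def by simp_all
qed

text \<open>The entry sum of \<open>u\<close> is a diagonal entry for the padded word, hence at most
  its trace. By \<open>trace_le_level\<close> this is at most the trace of a product of m + l
  matrices of standard words, each with entry sum at most 8 times its spectral radius.\<close>

lemma log_weight_prefix_le:
  assumes a1: "a 1 \<ge> 2" and a_pos: "\<And>i. i \<ge> 1 \<Longrightarrow> a i \<ge> 1"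
    and counts: "\<And>x. count_list (Zero # u @ [One]) x
      = m * count_list (sword a (k + 3)) x + l * count_list (sword a (k + 2)) x"
  shows "log_weight t u \<le> ln 2 + real m * (ln 8 + lrho a (k + 3)) + real l * (ln 8 + lrho a (k + 2))
    + real (count_list u One) * t"
proof -
  let ?u = "Zero # u @ [One]"
  have k3: "k + 3 = k + 1 + 2" by simp
  obtain v where v: "count_list v Zero = m" "count_list v One = l"
    "trace (word_prod A_mat ?u) \<le> trace (word_prod (level a (k + 2)) v)"
    using trace_le_level[of ?u m a "k + 2" l] counts by (auto simp: numeral_3_eq_3)
  have nn: "nonneg_mat (level a (k + 2) x)" for x
    by (cases x) (simp_all add: level_def nonneg_word_prod_A_mat)
  have "entry_sum (word_prod A_mat u) \<le> trace (word_prod A_mat ?u)"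
    using diagonal_word_prod_A_mat_ge_1(1)[of ?u] component22_zero_one[of u]
    by (simp add: trace_def sum_2)
  also have "\<dots> \<le> 2 * (entry_sum (level a (k + 2) Zero) ^ m * entry_sum (level a (k + 2) One) ^ l)"
    using trace_word_prod_le[of "level a (k + 2)" v, OF nn] v by simp
  also have "\<dots> \<le> 2 * ((8 * srho a (k + 3)) ^ m * (8 * srho a (k + 2)) ^ l)"
  proof (intro mult_left_mono mult_mono power_mono)
    show "entry_sum (level a (k + 2) Zero) \<le> 8 * srho a (k + 3)"
      using entry_sum_smat_le[of a "k + 1", OF a1 a_pos] by (simp add: level_def k3)
    show "entry_sum (level a (k + 2) One) \<le> 8 * srho a (k + 2)"
      using entry_sum_smat_le[of a k, OF a1 a_pos] by (simp add: level_def)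
  qed (use srho_ge_1[of a "k + 3"] entry_sum_nonneg[OF nn] in auto)
  finally have "ln (entry_sum (word_prod A_mat u))
      \<le> ln (2 * ((8 * srho a (k + 3)) ^ m * (8 * srho a (k + 2)) ^ l))"
    using entry_sum_word_prod_ge_1[of u] by (intro ln_mono) auto
  also have "\<dots> = ln 2 + real m * (ln 8 + lrho a (k + 3)) + real l * (ln 8 + lrho a (k + 2))"
    using srho_ge_1[of a "k + 3"] srho_ge_1[of a "k + 2"]
    by (simp add: ln_mult ln_realpow lrho_def algebra_simps)
  finally show ?thesis by (simp add: log_weight_def)
qed

text \<open>With \<open>c\<close> the logarithm of the joint spectral radius at \<open>\<alpha> = exp t\<close>, this measures how far the
  periodic word with period \<open>s\<^sub>n\<close> is from being optimal.\<close>

definition gap :: "(nat \<Rightarrow> nat) \<Rightarrow> real \<Rightarrow> real \<Rightarrow> nat \<Rightarrow> real" where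
  "gap a t c n = real (cfq a n) * c - lrho a (n + 1) - real (cfp a n) * t"

lemma gap_nonneg:
  assumes "(\<lambda>n. max_log_weight t n / real n) \<longlonglongrightarrow> c"
    and a_pos: "\<And>i. i \<ge> 1 \<Longrightarrow> a i \<ge> 1"
  shows "gap a t c n \<ge> 0"
proof -
  have "length (sword a (Suc n)) \<ge> 1"
    using cfq_pos[of a n, OF a_pos] by (simp add: cfq_def)
  then have "sword a (Suc n) \<noteq> []" by auto
  from log_spectral_radius_le[OF assms(1) this det_trace_smat(2)] show ?thesis
    by (simp add: gap_def cfq_def cfp_def lrho_def srho_def)
qed

lemma gap_rec:
  "gap a t c (n + 2) = real (a (n + 2)) * gap a t c (n + 1) + gap a t c n - defect a (n + 1)"
  unfolding gap_def defect_def cfp_simps(3) cfq_rec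
  by (simp add: sexp_def algebra_simps)

text \<open>The letter counts of a padded prefix of the extremal sequence are combinations of those
  of s_(j+2) and s_(j+1), with coefficients asymptotic to n e and n e'. Dividing the bound of
  \<open>log_weight_prefix_le\<close> by n gives an upper bound for c in which each copy of a
  standard word loses ln 8.\<close>

lemma gap_bounded:
  assumes a1: "a 1 \<ge> 2" and a_pos: "\<And>i. i \<ge> 1 \<Longrightarrow> a i \<ge> 1"
    and irr: "\<gamma> \<notin> \<rat>" and cf: "has_cf_expansion \<gamma> a"
    and lim: "(\<lambda>n. max_log_weight t n / real n) \<longlonglongrightarrow> c"
    and x: "(\<lambda>n. log_weight t (map x [0..<n]) / real n) \<longlonglongrightarrow> c"
    and freq: "(\<lambda>n. real (count_list (map x [0..<n]) One) / real n) \<longlonglongrightarrow> \<gamma>"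
  shows "gap a t c (j + 2) \<le> 2 * ln 8"
proof -
  define p q p' q' where "p = real (cfp a (j + 1))" and "q = real (cfq a (j + 1))"
    and "p' = real (cfp a (j + 2))" and "q' = real (cfq a (j + 2))"
  define \<epsilon> :: real where "\<epsilon> = (-1) ^ (j + 1)"
  have \<epsilon>2: "\<epsilon> * \<epsilon> = 1" unfolding \<epsilon>_def by (simp flip: power_add)
  define e e' where "e = cf_err a \<gamma> (j + 1)" and "e' = cf_err a \<gamma> (j + 2)"
  have e: "e = \<epsilon> * (\<gamma> * q - p)" "e' = \<epsilon> * (p' - \<gamma> * q')"
    by (simp_all add: e_def e'_def cf_err_def \<epsilon>_def p_def q_def p'_def q'_def algebra_simps)
  have e_pos: "e > 0" "e' > 0" and e_less: "e' < e"
    using cf_err_pos[of a \<gamma>, OF a_pos irr cf] cf_err_Suc_less[of a \<gamma> "j + 1", OF a_pos irr cf]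
    by (simp_all add: e_def e'_def)
  have det: "p' * q - q' * p = \<epsilon>"
    using cf_det[of a "j + 1", OF a_pos] by (simp add: p_def q_def p'_def q'_def \<epsilon>_def)
  have ident: "e * q' + e' * q = 1" "e * p' + e' * p = \<gamma>"
    using cf_err_identities[of a \<gamma> "j + 1", OF a_pos]
    by (simp_all add: e_def e'_def p_def q_def p'_def q'_def)
  define k where "k = (\<lambda>n. real (count_list (map x [0..<n]) One))"
  \<comment> \<open>Cramer's rule for the counts of \<open>Zero # map x [0..<n] @ [One]\<close>,
    whose two extra letters explain k n + 1 and n + 2.\<close>
  define m l where "m = (\<lambda>n. \<epsilon> * ((k n + 1) * q - (real n + 2) * p))"
    and "l = (\<lambda>n. \<epsilon> * ((real n + 2) * p' - (k n + 1) * q'))"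
  have ml: "m n * q' + l n * q = real n + 2" "m n * p' + l n * p = k n + 1" for n
  proof -
    have "m n * q' + l n * q = (real n + 2) * (\<epsilon> * (p' * q - q' * p))"
      by (simp add: m_def l_def algebra_simps)
    then show "m n * q' + l n * q = real n + 2" by (simp add: det \<epsilon>2)
    have "m n * p' + l n * p = (k n + 1) * (\<epsilon> * (p' * q - q' * p))"
      by (simp add: m_def l_def algebra_simps)
    then show "m n * p' + l n * p = k n + 1" by (simp add: det \<epsilon>2)
  qed
  have freq': "(\<lambda>n. k n / real n) \<longlonglongrightarrow> \<gamma>"
    using freq by (simp add: k_def)
  have one: "(\<lambda>n. (real n + d) / real n) \<longlonglongrightarrow> 1" for d
  proof -
    have "(\<lambda>n. 1 + d / real n) \<longlonglongrightarrow> 1 + 0"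
      by (intro tendsto_add tendsto_const tendsto_const_over_n)
    moreover have "\<forall>\<^sub>F n in sequentially. 1 + d / real n = (real n + d) / real n"
      by (intro eventually_sequentiallyI[of 1]) (simp add: add_divide_distrib)
    ultimately show ?thesis
      by (simp add: tendsto_cong)
  qed
  have kone: "(\<lambda>n. (k n + 1) / real n) \<longlonglongrightarrow> \<gamma>"
    using tendsto_add[OF freq' tendsto_const_over_n[of 1]] by (simp add: add_divide_distrib)
  have m_lim: "(\<lambda>n. m n / real n) \<longlonglongrightarrow> e"
  proof -
    have "(\<lambda>n. \<epsilon> * ((k n + 1) / real n * q - (real n + 2) / real n * p)) \<longlonglongrightarrow> \<epsilon> * (\<gamma> * q - 1 * p)"
      by (intro tendsto_intros kone one)
    then show ?thesis by (simp add: e m_def flip: diff_divide_distrib)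
  qed
  have l_lim: "(\<lambda>n. l n / real n) \<longlonglongrightarrow> e'"
  proof -
    have "(\<lambda>n. \<epsilon> * ((real n + 2) / real n * p' - (k n + 1) / real n * q')) \<longlonglongrightarrow> \<epsilon> * (1 * p' - \<gamma> * q')"
      by (intro tendsto_intros kone one)
    then show ?thesis by (simp add: e l_def flip: diff_divide_distrib)
  qed
  define bound where "bound = (\<lambda>n. ln 2 / real n + m n / real n * (ln 8 + lrho a (j + 3))
      + l n / real n * (ln 8 + lrho a (j + 2)) + k n / real n * t)"
  have "\<forall>\<^sub>F n in sequentially. 0 < m n / real n"
    by (rule order_tendstoD(1)[OF m_lim e_pos(1)])
  moreover have "\<forall>\<^sub>F n in sequentially. 0 < l n / real n"
    by (rule order_tendstoD(1)[OF l_lim e_pos(2)])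
  ultimately have "\<forall>\<^sub>F n in sequentially. log_weight t (map x [0..<n]) / real n \<le> bound n"
  proof eventually_elim
    case (elim n)
    then have n: "n > 0" and pos: "m n > 0" "l n > 0"
      by (auto simp: zero_less_divide_iff)
    define K where "K = int (count_list (map x [0..<n]) One) + 1"
    \<comment> \<open>The determinant is 1 or -1, so the coefficients are integers; being positive
      for large n, they are numbers of copies.\<close>
    define mi li where "mi = (-1) ^ (j + 1) * (K * int (cfq a (j + 1)) - (int n + 2) * int (cfp a (j + 1)))"
      and "li = (-1) ^ (j + 1) * ((int n + 2) * int (cfp a (j + 2)) - K * int (cfq a (j + 2)))"
    have mi: "m n = real_of_int mi" "l n = real_of_int li"
      by (simp_all add: m_def l_def mi_def li_def K_def k_def \<epsilon>_def p_def q_def p'_def q'_def)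
    then have mn: "m n = real (nat mi)" "l n = real (nat li)"
      using pos by simp_all
    let ?u = "Zero # map x [0..<n] @ [One]"
    have lens: "length ?u = nat mi * cfq a (j + 2) + nat li * cfq a (j + 1)"
    proof -
      have "real (length ?u) = real (nat mi * cfq a (j + 2) + nat li * cfq a (j + 1))"
        using ml(1)[of n] mn by (simp add: p_def q_def p'_def q'_def)
      then show ?thesis by (simp only: of_nat_eq_iff)
    qed
    have ones: "count_list ?u One = nat mi * cfp a (j + 2) + nat li * cfp a (j + 1)"
    proof -
      have "real (count_list ?u One) = real (nat mi * cfp a (j + 2) + nat li * cfp a (j + 1))"
        using ml(2)[of n] mn by (simp add: k_def p_def q_def p'_def q'_def)
      then show ?thesis by (simp only: of_nat_eq_iff)
    qed
    have "count_list ?u y = nat mi * count_list (sword a (j + 3)) y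
        + nat li * count_list (sword a (j + 2)) y" for y
    proof (cases y)
      case One
      then show ?thesis using ones by (simp add: cfp_def numeral_3_eq_3)
    next
      case Zero
      have "count_list ?u Zero + count_list ?u One =
        nat mi * (count_list (sword a (j + 3)) Zero + count_list (sword a (j + 3)) One)
        + nat li * (count_list (sword a (j + 2)) Zero + count_list (sword a (j + 2)) One)"
        using lens unfolding cfq_def length_count_list by (simp add: numeral_3_eq_3)
      then show ?thesis
        using ones Zero unfolding cfp_def by (simp add: numeral_3_eq_3 algebra_simps)
    qed
    from log_weight_prefix_le[OF a1 a_pos this, of t]
    have "log_weight t (map x [0..<n]) \<le> ln 2 + m n * (ln 8 + lrho a (j + 3))
        + l n * (ln 8 + lrho a (j + 2)) + k n * t"
      by (simp add: mn k_def)
    then have "log_weight t (map x [0..<n]) / real n \<le> (ln 2 + m n * (ln 8 + lrho a (j + 3))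
        + l n * (ln 8 + lrho a (j + 2)) + k n * t) / real n"
      by (rule divide_right_mono) simp
    then show ?case by (simp add: bound_def add_divide_distrib)
  qed
  moreover have "bound \<longlonglongrightarrow> 0 + e * (ln 8 + lrho a (j + 3)) + e' * (ln 8 + lrho a (j + 2)) + \<gamma> * t"
    unfolding bound_def by (intro tendsto_intros tendsto_const_over_n m_lim l_lim freq')
  ultimately have c_le: "c \<le> e * (ln 8 + lrho a (j + 3)) + e' * (ln 8 + lrho a (j + 2)) + \<gamma> * t"
    using tendsto_le[OF sequentially_bot _ x] by simp
  \<comment> \<open>The weighted sum of two consecutive gaps is c minus its upper bound without the
    ln 8 terms. Although e may be tiny, dividing by it is harmless because e' < e.\<close>
  have "e * gap a t c (j + 2) + e' * gap a t c (j + 1)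
      = (e * q' + e' * q) * c - e * lrho a (j + 3) - e' * lrho a (j + 2) - (e * p' + e' * p) * t"
    by (simp add: gap_def p_def q_def p'_def q'_def numeral_eq_Suc algebra_simps)
  also have "\<dots> \<le> (e + e') * ln 8"
    using c_le unfolding ident by (simp add: algebra_simps)
  also have "\<dots> \<le> (2 * e) * ln 8"
    using e_less by (intro mult_right_mono) auto
  finally have "e * gap a t c (j + 2) + e' * gap a t c (j + 1) \<le> e * (2 * ln 8)" by simp
  moreover have "e' * gap a t c (j + 1) \<ge> 0"
    using e_pos gap_nonneg[OF lim a_pos] by simp
  ultimately have "e * gap a t c (j + 2) \<le> e * (2 * ln 8)" by linarith
  then show ?thesis using e_pos(1) by simp
qed

text \<open>The coefficient of \<open>lrho a (n + 1)\<close> for 1 <= n < N is, up to sign, a_(n+1)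
  q_n + q_(n-1) - q_(n+1) = 0. At the lower end \<open>lrho a 0\<close> and \<open>lrho a 1\<close>
  vanish, so only the two top terms remain.\<close>

lemma ln_partial_product:
  "ln (\<Prod>n=0..N. (srho a (Suc n) ^ a (n + 1) * srho a n / srho a (n + 2))
      powi ((-1) ^ n * int (cfq a n)))
    = (-1) ^ N * (real (cfq a (Suc N)) * lrho a (Suc N) - real (cfq a N) * lrho a (N + 2))"
proof -
  have pos: "srho a n > 0" for n
    using srho_ge_1[of a n] by linarith
  define y where "y = (\<lambda>n. real (a (n + 1)) * lrho a (Suc n) + lrho a n - lrho a (n + 2))"
  have base: "srho a (Suc n) ^ a (n + 1) * srho a n / srho a (n + 2) = exp (y n)" for n
    using pos by (simp add: y_def exp_add exp_diff exp_of_nat_mult lrho_def)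
  have "(\<Prod>n=0..N. (srho a (Suc n) ^ a (n + 1) * srho a n / srho a (n + 2))
      powi ((-1) ^ n * int (cfq a n)))
    = exp (\<Sum>n=0..N. of_int ((-1) ^ n * int (cfq a n)) * y n)"
    unfolding base by (simp add: exp_sum exp_power_int)
  then have "ln (\<Prod>n=0..N. (srho a (Suc n) ^ a (n + 1) * srho a n / srho a (n + 2))
      powi ((-1) ^ n * int (cfq a n))) = (\<Sum>n=0..N. (-1) ^ n * real (cfq a n) * y n)"
    by simp
  also have "\<dots> = (-1) ^ N * (real (cfq a (Suc N)) * lrho a (Suc N) - real (cfq a N) * lrho a (N + 2))"
  proof (induction N)
    case 0
    have "lrho a 0 = 0" "lrho a (Suc 0) = 0"
      using srho_0[of a] by (simp_all add: lrho_def)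
    then show ?case by (simp add: y_def cfq_0)
  next
    case (Suc N)
    then show ?case
      using cfq_rec[of a N] by (simp add: y_def numeral_eq_Suc algebra_simps)
  qed
  finally show ?thesis .
qed

text \<open>As partial quotients are at least 1, \<open>gap_rec\<close> gives D_n + D_(n+1) <=
  D_(n+2) plus a defect; summing over n telescopes.\<close>

lemma sum_gap_le:
  assumes a_pos: "\<And>i. i \<ge> 1 \<Longrightarrow> a i \<ge> 1"
    and nonneg: "\<And>n. gap a t c n \<ge> 0"
  shows "(\<Sum>i<M. gap a t c (N + i)) + gap a t c (N + 1)
    \<le> gap a t c (N + M + 1) + (\<Sum>i<M. defect a (N + 1 + i))"
proof (induction M)
  case (Suc M)
  have "1 * gap a t c (N + M + 1) \<le> real (a (N + M + 2)) * gap a t c (N + M + 1)"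
    using a_pos[of "N + M + 2"] nonneg by (intro mult_right_mono) auto
  then have "gap a t c (N + M) + gap a t c (N + M + 1) \<le> gap a t c (N + M + 2) + defect a (N + M + 1)"
    using gap_rec[of a t c "N + M"] by simp
  with Suc show ?case by simp
qed simp

text \<open>On the right the terms with c cancel, and those with t combine to the determinant of two
  consecutive convergents.\<close>

lemma log_alpha_minus_partial_product:
  assumes "\<And>i. i \<ge> 1 \<Longrightarrow> a i \<ge> 1"
  shows "t - (-1) ^ N * (real (cfq a (Suc N)) * lrho a (Suc N) - real (cfq a N) * lrho a (N + 2))
    = (-1) ^ N * (real (cfq a (Suc N)) * gap a t c N - real (cfq a N) * gap a t c (Suc N))"
proof -
  define s :: real where "s = (-1) ^ N"
  have s: "s * s = 1" unfolding s_def by (simp flip: power_add)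
  have "t = s * (real (cfp a (Suc N)) * real (cfq a N) - real (cfq a (Suc N)) * real (cfp a N)) * t"
    using cf_det[of a N, OF assms] s by (simp add: s_def)
  then show ?thesis
    unfolding gap_def s_def[symmetric] by (simp add: algebra_simps)
qed

text \<open>Summing the recursion for the gaps shows that they tend to zero, since they are bounded and the
  defects are summable; the same sum then bounds the gaps by the tail of the defects.\<close>

lemma gap_tail_bound:
  assumes a1: "a 1 \<ge> 2" and a_pos: "\<And>i. i \<ge> 1 \<Longrightarrow> a i \<ge> 1"
    and nonneg: "\<And>n. gap a t c n \<ge> 0" and bdd: "\<And>n. gap a t c (n + 2) \<le> C"
    and L: "L > 0" and N: "N \<ge> 3"
    and q_le: "\<And>n. n > N \<Longrightarrow> real (cfq a n) \<le> L * srho a n"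
  shows "real (cfq a (Suc N)) * (gap a t c N + gap a t c (Suc N)) \<le> 8 / 3 * L / srho a (Suc N)"
proof -
  define Q H where "Q = real (cfq a (Suc N))" and "H = 8 / 3 * L / srho a (Suc N)"
  have Q1: "Q \<ge> 1" using cfq_pos[of a "Suc N", OF a_pos] by (simp add: Q_def)
  have cfq_mono: "Q \<le> real (cfq a (N + 1 + i))" for i
  proof (induction i)
    case (Suc i)
    then show ?case using cfq_Suc_ge[of a "N + 1 + i", OF a_pos] by simp
  qed (simp add: Q_def)
  have R: "srho a n > 0" for n using srho_ge_1[of a n] by linarith
  have R_grow: "2 ^ i * srho a (Suc N) \<le> srho a (Suc N + i)" for i
  proof (induction i)
    case (Suc i)
    obtain k where "Suc N + i = k + 3"
      using N by (metis add.commute le_Suc_ex le_SucI trans_le_add1)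
    then have "2 * srho a (Suc N + i) \<le> srho a (Suc N + Suc i)"
      using srho_double[of a k, OF a1 a_pos] by (simp add: numeral_eq_Suc)
    with Suc show ?case by simp
  qed simp
  \<comment> \<open>The growth hypothesis bounds \<open>Q\<close> by L r, which cancels one of the
    two radii in \<open>defect_le\<close>. The other one at least doubles with i, so the terms are
    dominated by a geometric series of sum \<open>H\<close>.\<close>
  have term_le: "Q * defect a (N + 1 + i) \<le> H * (1 / 2) ^ Suc i" for i
  proof -
    define r r' where "r = srho a (N + 1 + i)" and "r' = srho a (N + 2 + i)"
    have rr: "r > 0" "r' > 0" by (simp_all add: r_def r'_def R)
    have "r' \<ge> 2"
      using srho_ge_2[of a "N + i", OF a1 a_pos] by (simp add: r'_def)
    then have defect: "defect a (N + 1 + i) \<le> 8 / 3 / (r' * r)"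
      using defect_le[of a "N + 1 + i"] by (simp add: r_def r'_def)
    have "Q * defect a (N + 1 + i) \<le> (L * r) * (8 / 3 / (r' * r))"
    proof (rule mult_mono[OF _ defect])
      show "Q \<le> L * r"
        using cfq_mono[of i] q_le[of "N + 1 + i"] by (simp add: r_def)
    qed (use L rr defect_nonneg in auto)
    also have "\<dots> = 8 / 3 * L / r'" using rr by (simp add: field_simps)
    also have "\<dots> \<le> 8 / 3 * L / (2 ^ Suc i * srho a (Suc N))"
      using R_grow[of "Suc i"] L rr R[of "Suc N"] by (intro divide_left_mono) (auto simp: r'_def)
    also have "\<dots> = H * (1 / 2) ^ Suc i" by (simp add: H_def field_simps)
    finally show ?thesis .
  qed
  have sum_le: "Q * (\<Sum>i<M. defect a (N + 1 + i)) \<le> H" for M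
  proof -
    have "Q * (\<Sum>i<M. defect a (N + 1 + i)) \<le> (\<Sum>i<M. H * (1 / 2) ^ Suc i)"
      unfolding sum_distrib_left by (intro sum_mono term_le)
    also have "\<dots> = H * (1 - (1 / 2) ^ M)"
      by (induction M) (simp_all add: algebra_simps)
    also have "\<dots> \<le> H * 1"
      using L R[of "Suc N"] by (intro mult_left_mono) (auto simp: H_def)
    finally show ?thesis by simp
  qed
  have main: "Q * ((\<Sum>i<M. gap a t c (N + i)) + gap a t c (N + 1)) \<le> Q * gap a t c (N + M + 1) + H" for M
  proof -
    have "Q * ((\<Sum>i<M. gap a t c (N + i)) + gap a t c (N + 1))
        \<le> Q * (gap a t c (N + M + 1) + (\<Sum>i<M. defect a (N + 1 + i)))"
      using Q1 sum_gap_le[OF a_pos nonneg] by (intro mult_left_mono) auto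
    with sum_le[of M] show ?thesis by (simp add: distrib_left)
  qed
  \<comment> \<open>The bound \<open>C\<close> makes the series of gaps converge. The gaps then tend
    to 0, and \<open>C\<close> disappears from the final estimate.\<close>
  have "(\<Sum>i<M. gap a t c (N + i)) \<le> C + H" for M
  proof -
    have "gap a t c (N + M + 1) \<le> C"
      using bdd[of "N + M - 1"] N by simp
    then have "Q * gap a t c (N + M + 1) \<le> Q * C" using Q1 by (intro mult_left_mono) auto
    moreover have "H \<le> Q * H"
      using Q1 L R[of "Suc N"] mult_right_mono[of 1 Q H] by (simp add: H_def)
    moreover have "Q * (\<Sum>i<M. gap a t c (N + i)) \<le> Q * ((\<Sum>i<M. gap a t c (N + i)) + gap a t c (N + 1))"
      using Q1 nonneg[of "N + 1"] by (intro mult_left_mono) auto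
    ultimately have "Q * (\<Sum>i<M. gap a t c (N + i)) \<le> Q * (C + H)"
      using main[of M] unfolding distrib_left by linarith
    then show ?thesis using Q1 by simp
  qed
  then have "summable (\<lambda>i. gap a t c (N + i))"
    using nonneg by (intro summableI_nonneg_bounded)
  then have "(\<lambda>i. gap a t c (N + i)) \<longlonglongrightarrow> 0"
    by (rule summable_LIMSEQ_zero)
  from LIMSEQ_ignore_initial_segment[OF this, of 1]
  have "(\<lambda>M. gap a t c (N + M + 1)) \<longlonglongrightarrow> 0" by (simp add: add.assoc)
  from tendsto_add[OF tendsto_mult[OF tendsto_const[of Q] this] tendsto_const[of H]]
  have lim: "(\<lambda>M. Q * gap a t c (N + M + 1) + H) \<longlonglongrightarrow> H" by simp
  have "Q * (gap a t c N + gap a t c (N + 1)) \<le> Q * gap a t c (N + M + 1) + H" if "M \<ge> 1" for M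
  proof -
    have "gap a t c N \<le> (\<Sum>i<M. gap a t c (N + i))"
      using member_le_sum[of 0 "{..<M}" "\<lambda>i. gap a t c (N + i)"] nonneg that by auto
    then have "Q * (gap a t c N + gap a t c (N + 1)) \<le> Q * ((\<Sum>i<M. gap a t c (N + i)) + gap a t c (N + 1))"
      using Q1 by (intro mult_left_mono) auto
    with main[of M] show ?thesis by linarith
  qed
  then have "Q * (gap a t c N + gap a t c (N + 1)) \<le> H"
    by (intro LIMSEQ_le_const[OF lim]) auto
  then show ?thesis by (simp add: Q_def H_def)
qed

section \<open>From the extremal sequence at alpha to the error bound\<close>

lemma card_One_eq_count: "card {i. i < n \<and> x i = One} = count_list (map x [0..<n]) One"
proof (induction n)
  case (Suc n)
  have "{i. i < Suc n \<and> x i = One} = (if x n = One then insert n {i. i < n \<and> x i = One} else {i. i < n \<and> x i = One})"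
    by (auto simp: less_Suc_eq)
  then show ?case using Suc by simp
qed simp

theorem proposition8p2:
  fixes r :: "real \<Rightarrow> real" and \<gamma> \<alpha> L :: real and a :: "nat \<Rightarrow> nat" and n0 :: nat
  assumes "is_one_ratio_function r"
    and "0 < \<gamma>" and "\<gamma> < 1/2" and "\<gamma> \<notin> \<rat>"
    and "has_cf_expansion \<gamma> a"
    and "r -` {\<gamma>} \<inter> {0..} = {\<alpha>}"
    and "L > 0" and "n0 \<ge> 3"
    and "\<And>n. n > n0 \<Longrightarrow> real_of_int (cf_q a n) \<le> L * rho a (int n - 1)"
  shows "\<forall>N\<ge>n0.
     \<bar>ln \<alpha> - ln (\<Prod>n=0..N.
         (rho a (int n) ^ a (n + 1) * rho a (int n - 1) / rho a (int n + 1))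
           powi ((-1) ^ n * cf_q a n))\<bar>
     \<le> 2 * L * (16 * (real (a 1) + 1) * (real (a 1) + 2) + 1) / rho a (int N)"
proof (intro allI impI)
  fix N assume N: "n0 \<le> N"
  have a_pos: "a i \<ge> 1" if "i \<ge> 1" for i
    using assms(5) that by (simp add: has_cf_expansion_def)
  have a1: "a 1 \<ge> 2"
    by (rule first_quotient_ge_2[of a \<gamma>, OF a_pos assms(4,5,3)])
  have "\<alpha> \<in> r -` {\<gamma>} \<inter> {0..}" using assms(6) by simp
  then have \<alpha>: "\<alpha> \<ge> 0" "r \<alpha> = \<gamma>" by auto
  have freq: "(\<lambda>n. real (count_list (map x [0..<n]) One) / real n) \<longlonglongrightarrow> r \<beta>"
    if "\<beta> \<ge> 0" "(\<lambda>n. growth (A_weighted \<beta>) (map x [0..<n])) \<longlonglongrightarrow> joint_spectral_radius (A_weighted \<beta>)"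
    for x \<beta>
    using assms(1) that unfolding is_one_ratio_function_def card_One_eq_count by blast
  have "\<alpha> \<noteq> 0"
  proof
    assume "\<alpha> = 0"
    have "(\<lambda>n. real (count_list (map (\<lambda>_. Zero) [0..<n]) One) / real n) \<longlonglongrightarrow> \<gamma>"
      using freq[OF _ growth_A_weighted_0_tendsto] \<alpha>(2) \<open>\<alpha> = 0\<close> by simp
    moreover have "count_list (map (\<lambda>_. Zero) [0..<n]) One = 0" for n :: nat
      by (auto simp: count_list_0_iff)
    ultimately have "\<gamma> = 0" by (simp add: LIMSEQ_const_iff)
    with assms(2) show False by simp
  qed
  then have \<alpha>_pos: "\<alpha> > 0" using \<alpha>(1) by simp
  define t where "t = ln \<alpha>"
  obtain c where c: "(\<lambda>n. max_log_weight t n / real n) \<longlonglongrightarrow> c"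
    "\<And>n. real n * c \<le> max_log_weight t n" "c \<ge> 0"
    using fekete[of "max_log_weight t"] max_log_weight_subadditive max_log_weight_nonneg by blast
  obtain x where x: "(\<lambda>n. log_weight t (map x [0..<n]) / real n) \<longlonglongrightarrow> c"
    using extremal_sequence_exists[OF c] by blast
  have "(\<lambda>n. growth (A_weighted \<alpha>) (map x [0..<n])) \<longlonglongrightarrow> joint_spectral_radius (A_weighted \<alpha>)"
    using growth_tendsto_iff[OF \<alpha>_pos, of x c] joint_spectral_radius_eq[OF \<alpha>_pos, of c] x c(1)
    by (simp add: t_def)
  from freq[OF \<alpha>(1) this] \<alpha>(2)
  have x_freq: "(\<lambda>n. real (count_list (map x [0..<n]) One) / real n) \<longlonglongrightarrow> \<gamma>" by simp
  note nonneg = gap_nonneg[of t c a, OF c(1) a_pos]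
  note bdd = gap_bounded[of a \<gamma> t c x, OF a1 a_pos assms(4,5) c(1) x x_freq]
  have tail: "real (cfq a (Suc N)) * (gap a t c N + gap a t c (Suc N)) \<le> 8 / 3 * L / srho a (Suc N)"
  proof (rule gap_tail_bound[OF a1 a_pos nonneg bdd assms(7)])
    show "N \<ge> 3" using N assms(8) by simp
    show "real (cfq a n) \<le> L * srho a n" if "n > N" for n
      using assms(9)[of n] that N cf_q_eq[of a n, OF a_pos] by (simp add: rho_eq_srho)
  qed
  have cf_q: "cf_q a n = int (cfq a n)" for n
    by (rule cf_q_eq) (rule a_pos)
  have q_mono: "real (cfq a N) \<le> real (cfq a (Suc N))"
    using cfq_Suc_ge[of a N, OF a_pos] by simp
  define P where "P = (\<Prod>n=0..N. (rho a (int n) ^ a (n + 1) * rho a (int n - 1) / rho a (int n + 1))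
           powi ((-1) ^ n * cf_q a n))"
  have "ln P = (-1) ^ N * (real (cfq a (Suc N)) * lrho a (Suc N) - real (cfq a N) * lrho a (N + 2))"
    unfolding P_def rho_eq_srho cf_q by (rule ln_partial_product)
  then have "\<bar>ln \<alpha> - ln P\<bar>
      = \<bar>real (cfq a (Suc N)) * gap a t c N - real (cfq a N) * gap a t c (Suc N)\<bar>"
    using log_alpha_minus_partial_product[of a t N c, OF a_pos] by (simp add: t_def abs_mult)
  also have "\<dots> \<le> real (cfq a (Suc N)) * gap a t c N + real (cfq a (Suc N)) * gap a t c (Suc N)"
  proof -
    have "0 \<le> real (cfq a (Suc N)) * gap a t c N" "0 \<le> real (cfq a N) * gap a t c (Suc N)"
      by (simp_all add: nonneg)
    with mult_right_mono[OF q_mono nonneg[of "Suc N"]] show ?thesis by linarith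
  qed
  also have "\<dots> \<le> 8 / 3 * L / srho a (Suc N)"
    using tail by (simp add: distrib_left)
  \<comment> \<open>It remains to compare 8 / 3 with 2 C_0, where C_0 = k + 1 and k >= 1.\<close>
  also have "\<dots> \<le> 2 * L * (16 * (real (a 1) + 1) * (real (a 1) + 2) + 1) / srho a (Suc N)"
  proof (rule divide_right_mono)
    define k where "k = 16 * (real (a 1) + 1) * (real (a 1) + 2)"
    have "1 \<le> k"
      unfolding k_def by (simp add: algebra_simps)
    then have "8 / 3 \<le> 2 * (k + 1)" by simp
    from mult_left_mono[OF this, of L] assms(7)
    show "8 / 3 * L \<le> 2 * L * (16 * (real (a 1) + 1) * (real (a 1) + 2) + 1)"
      unfolding k_def[symmetric] by (simp add: mult_ac)
    show "0 \<le> srho a (Suc N)" using srho_ge_1[of a "Suc N"] by linarith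
  qed
  finally show "\<bar>ln \<alpha> - ln (\<Prod>n=0..N.
         (rho a (int n) ^ a (n + 1) * rho a (int n - 1) / rho a (int n + 1))
           powi ((-1) ^ n * cf_q a n))\<bar>
     \<le> 2 * L * (16 * (real (a 1) + 1) * (real (a 1) + 2) + 1) / rho a (int N)"
    by (simp add: P_def rho_eq_srho)
qed

end
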